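(* Let $n\ge 4$. The Parke--Taylor variety $\mathrm{PT}_n\subset\mathbb{P}^{(n-2)!-1}$ is linearly isomorphic to the log canonical embedding $\mathrm{LC}_n\subset\mathbb{P}^{(n-2)!-1}$ of $\overline{\mathcal{M}}_{0,n}$ (i.e. there is an invertible linear change of homogeneous coordinates carrying $\mathrm{PT}_n$ onto $\mathrm{LC}_n$), and thus $\mathrm{PT}_n$ is the image of a closed embedding of $\overline{\mathcal{M}}_{0,n}$ into $\mathbb{P}^{(n-2)!-1}$. For $n\ge 6$, such a linear isomorphism from $\mathrm{PT}_n$ (coordinates $z_\tau$) to $\mathrm{LC}_n$ (coordinates $t_{i_1\ldots i_{n-3}}$) is given by $$t_{i_1\ldots i_{n-3}}=\sum_{\sigma\in B_{i_1\ldots i_{n-4}}} Z_{\,i_{n-3}+1,\,\sigma},$$ where $B_{i_1\ldots i_{n-4}}\subseteq\Sigma_{n-1}$ is the set such that the corresponding isomorphism for $n-1$ reads $t_{i_1\ldots i_{n-4}}=\sum_{\sigma\in B_{i_1\ldots i_{n-4}}}z_\sigma$; the base case of this recursion is the isomorphism for $n=5$ recalled in the context.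
   Context: All varieties are over $\mathbb{C}$. Parke--Taylor variety. $\mathrm{Gr}(2,n)$ has Pl\"ucker coordinates $p_{ij}$, $p_{ji}=-p_{ij}$. For a permutation $\sigma$ of $[n]$ let $f_\sigma=\prod_{i=1}^n \frac{1}{p_{\sigma_i\sigma_{i+1}}}$ with $\sigma_{n+1}:=\sigma_1$. $\Sigma_n$ is the set of permutations $\sigma$ of $[n]$ with $\sigma_1=1,\sigma_2=2$, and $z_\sigma$ ($\sigma\in\Sigma_n$) are homogeneous coordinates on $\mathbb{P}^{(n-2)!-1}$. $\mathrm{PT}_n$ is the Zariski closure of the image of $V\mapsto(f_\sigma(V))_{\sigma\in\Sigma_n}$, defined on the locus of $\mathrm{Gr}(2,n)$ where all $p_{ij}\ne0$. Log canonical embedding. $\overline{\mathcal{M}}_{0,n}$ is the Deligne--Knudsen--Mumford moduli space of stable $n$-pointed rational curves, containing $\mathcal{M}_{0,n}$ as a dense open subset. The iterated Kapranov embedding $\Omega_n:\overline{\mathcal{M}}_{0,n}\to\mathbb{P}^1\times\mathbb{P}^2\times\cdots\times\mathbb{P}^{n-3}$ (a closed embedding) is given on $\mathcal{M}_{0,n}$, for distinct points with affine coordinates $p_1,\dots,p_n\in\mathbb{C}$, by having $m$-th component ($1\le m\le n-3$) equal to $$\left[\tfrac{p_1-p_2}{p_{m+3}-p_2}:\tfrac{p_1-p_3}{p_{m+3}-p_3}:\cdots:\tfrac{p_1-p_{m+2}}{p_{m+3}-p_{m+2}}\right]\in\mathbb{P}^m .$$ $\Phi_n$ is the composition of $\Omega_n$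 with the Segre embedding into $\mathbb{P}^{(n-2)!-1}$, whose coordinates are $t_{i_1\ldots i_{n-3}}$ with $i_m\in\{1,\dots,m+1\}$ ($t_{i_1\ldots i_{n-3}}$ is the product over $m$ of the $i_m$-th coordinate of the $m$-th factor). $\mathrm{LC}_n$ is the closure of the image of $\Phi_n$. The linear forms $Z_{a,\sigma}$. For $\sigma\in\Sigma_{n-1}$ and $a\in\{2,\dots,n-1\}$, $Z_{a,\sigma}=\sum_\tau z_\tau$, the sum over all $\tau\in\Sigma_n$ such that deleting the letter $n$ from the one-line notation of $\tau$ gives $\sigma$ and the letter $n$ appears to the right of the letter $a$ in $\tau$. Base case $n=5$ (defining the sets $B_{i_1i_2}$): $t_{11}=z_{12345}+z_{12354}+z_{12435}+z_{12453}+z_{12534}+z_{12543}$, $t_{12}=z_{12345}+z_{12354}+z_{12435}$, $t_{13}=z_{12345}+z_{12435}+z_{12453}$, $t_{21}=z_{12345}+z_{12354}+z_{12534}$, $t_{22}=z_{12345}+z_{12354}$, $t_{23}=z_{12345}$. *)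

theory Defs
  imports "HOL-Analysis.Analysis"
begin

section \<open>Products of projective spaces\<close>

text \<open>
  Let \<open>J\<close> be a finite set of coordinates and let \<open>b\<close> assign to each coordinate a block.
  The classes of coordinate vectors having a nonzero entry in every block, modulo rescaling the
  blocks independently, are the points (in multihomogeneous coordinates) of the product over the
  blocks \<open>k\<close> of the projective spaces with homogeneous coordinates \<open>{j \<in> J. b j = k}\<close>.
  A single projective space is the case of a constant \<open>b\<close>.
  A point is the set of all its coordinate vectors.
\<close>

definition vecs :: "'j set \<Rightarrow> ('j \<Rightarrow> complex) set" where
  "vecs J = {x. \<forall>j. j \<notin> J \<longrightarrow> x j = 0}"

definition mpoint :: "('j \<Rightarrow> 'k) \<Rightarrow> ('j \<Rightarrow> complex) \<Rightarrow> ('j \<Rightarrow> complex) set" where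
  "mpoint b x = {y. \<exists>c :: 'k \<Rightarrow> complex. (\<forall>k. c k \<noteq> 0) \<and> y = (\<lambda>j. c (b j) * x j)}"

definition mproj_points :: "'j set \<Rightarrow> ('j \<Rightarrow> 'k) \<Rightarrow> ('j \<Rightarrow> complex) set set" where
  "mproj_points J b =
     {mpoint b x | x. x \<in> vecs J \<and> (\<forall>k \<in> b ` J. \<exists>j \<in> J. b j = k \<and> x j \<noteq> 0)}"

text \<open>
  \<open>mhom J b d F\<close>: \<open>F\<close> is the function of a polynomial in the coordinates from \<open>J\<close> that is
  homogeneous of degree \<open>d k\<close> in the coordinates of each block \<open>k\<close> (or zero).
\<close>

inductive mhom :: "'j set \<Rightarrow> ('j \<Rightarrow> 'k) \<Rightarrow> ('k \<Rightarrow> nat) \<Rightarrow> (('j \<Rightarrow> complex) \<Rightarrow> complex) \<Rightarrow> bool"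
  for J b where
  const: "mhom J b (\<lambda>_. 0) (\<lambda>_. c)"
| coord: "j \<in> J \<Longrightarrow> mhom J b (\<lambda>k. if k = b j then 1 else 0) (\<lambda>x. x j)"
| add: "mhom J b d F \<Longrightarrow> mhom J b d G \<Longrightarrow> mhom J b d (\<lambda>x. F x + G x)"
| mult: "mhom J b d F \<Longrightarrow> mhom J b e G \<Longrightarrow> mhom J b (\<lambda>k. d k + e k) (\<lambda>x. F x * G x)"

definition zero_locus ::
  "'j set \<Rightarrow> ('j \<Rightarrow> 'k) \<Rightarrow> (('j \<Rightarrow> complex) \<Rightarrow> complex) set \<Rightarrow> ('j \<Rightarrow> complex) set set" where
  "zero_locus J b S = {P \<in> mproj_points J b. \<forall>F \<in> S. \<forall>x \<in> P. F x = 0}"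

definition zariski :: "'j set \<Rightarrow> ('j \<Rightarrow> 'k) \<Rightarrow> ('j \<Rightarrow> complex) set topology" where
  "zariski J b =
     topology (\<lambda>U. \<exists>S \<subseteq> {F. \<exists>d. mhom J b d F}. U = mproj_points J b - zero_locus J b S)"

lemma mpoint_self: "x \<in> mpoint b x"
  unfolding mpoint_def by (simp, rule exI[of _ "\<lambda>_. 1"]) simp

lemma mhom_finite_degree: "mhom J b d F \<Longrightarrow> finite {k. d k \<noteq> 0}"
proof (induction rule: mhom.induct)
  case (mult d F e G)
  have "{k. d k + e k \<noteq> 0} \<subseteq> {k. d k \<noteq> 0} \<union> {k. e k \<noteq> 0}" by auto
  then show ?case using mult.IH by (meson finite_UnI finite_subset)
qed auto

lemma mhom_rescale:
  fixes c :: "'k \<Rightarrow> complex" and b :: "'j \<Rightarrow> 'k"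
  assumes "mhom J b d F"
  shows "F (\<lambda>j. c (b j) * x j) = (\<Prod>k | d k \<noteq> 0. c k ^ d k) * F x"
  using assms
proof (induction rule: mhom.induct)
  case (mult d F e G)
  let ?A = "{k. d k \<noteq> 0}" and ?B = "{k. e k \<noteq> 0}" and ?C = "{k. d k + e k \<noteq> 0}"
  have fin: "finite ?A" "finite ?B" using mult.hyps mhom_finite_degree by blast+
  have C: "?C = ?A \<union> ?B" by auto
  have "(\<Prod>k\<in>?C. c k ^ (d k + e k)) = (\<Prod>k\<in>?C. c k ^ d k) * (\<Prod>k\<in>?C. c k ^ e k)"
    by (simp add: power_add prod.distrib)
  moreover have "(\<Prod>k\<in>?C. c k ^ d k) = (\<Prod>k\<in>?A. c k ^ d k)"
    unfolding C by (rule prod.mono_neutral_right) (use fin in auto)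
  moreover have "(\<Prod>k\<in>?C. c k ^ e k) = (\<Prod>k\<in>?B. c k ^ e k)"
    unfolding C by (rule prod.mono_neutral_right) (use fin in auto)
  ultimately show ?case using mult.IH by (simp add: algebra_simps)
qed (auto simp: algebra_simps)

lemma mhom_vanish_iff:
  assumes "mhom J b d F"
  shows "(\<forall>y \<in> mpoint b x. F y = 0) \<longleftrightarrow> F x = 0"
proof
  show "F x = 0" if "\<forall>y \<in> mpoint b x. F y = 0" using that mpoint_self by blast
  show "\<forall>y \<in> mpoint b x. F y = 0" if "F x = 0"
    using that by (auto simp: mpoint_def mhom_rescale[OF assms])
qed

lemma zero_locus_Un:
  assumes "S \<subseteq> {F. \<exists>d. mhom J b d F}" "T \<subseteq> {F. \<exists>d. mhom J b d F}"
  shows "zero_locus J b S \<union> zero_locus J b T =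
         zero_locus J b {\<lambda>x. F x * G x | F G. F \<in> S \<and> G \<in> T}" (is "?L = ?R")
proof
  show "?L \<subseteq> ?R" unfolding zero_locus_def by fastforce
  show "?R \<subseteq> ?L"
  proof
    fix P assume P: "P \<in> ?R"
    then obtain x where x: "P = mpoint b x" by (auto simp: zero_locus_def mproj_points_def)
    show "P \<in> ?L"
    proof (rule ccontr)
      assume "P \<notin> ?L"
      then obtain F G where FG: "F \<in> S" "G \<in> T" "\<not> (\<forall>y\<in>P. F y = 0)" "\<not> (\<forall>y\<in>P. G y = 0)"
        using P unfolding zero_locus_def by blast
      then obtain d e where "mhom J b d F" "mhom J b e G" using assms by blast
      then have "F x \<noteq> 0" "G x \<noteq> 0"
        using FG(3,4) mhom_vanish_iff unfolding x by metis+
      moreover have "(\<lambda>x. F x * G x) \<in> {\<lambda>x. F x * G x | F G. F \<in> S \<and> G \<in> T}"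
        using FG(1,2) by blast
      then have "F x * G x = 0"
        using P mpoint_self[of x b] unfolding zero_locus_def x by fast
      ultimately show False by simp
    qed
  qed
qed

lemma istopology_zariski:
  "istopology (\<lambda>U. \<exists>S \<subseteq> {F. \<exists>d. mhom J b d F}. U = mproj_points J b - zero_locus J b S)"
    (is "istopology ?op")
  unfolding istopology_def
proof (intro conjI allI impI)
  fix U V assume "?op U" "?op V"
  then obtain S T where S: "S \<subseteq> {F. \<exists>d. mhom J b d F}" "U = mproj_points J b - zero_locus J b S"
    and T: "T \<subseteq> {F. \<exists>d. mhom J b d F}" "V = mproj_points J b - zero_locus J b T"
    by blast
  let ?R = "{\<lambda>x. F x * G x | F G. F \<in> S \<and> G \<in> T}"
  have "?R \<subseteq> {F. \<exists>d. mhom J b d F}" using S(1) T(1) by (blast intro: mhom.mult)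
  moreover have "U \<inter> V = mproj_points J b - zero_locus J b ?R"
    unfolding zero_locus_Un[OF S(1) T(1), symmetric] S(2) T(2) by blast
  ultimately show "?op (U \<inter> V)" by blast
next
  fix \<U> assume "\<forall>U\<in>\<U>. ?op U"
  then obtain S where S: "\<And>U. U \<in> \<U> \<Longrightarrow> S U \<subseteq> {F. \<exists>d. mhom J b d F}"
    "\<And>U. U \<in> \<U> \<Longrightarrow> U = mproj_points J b - zero_locus J b (S U)"
    by metis
  have "\<Union>\<U> = (\<Union>U\<in>\<U>. mproj_points J b - zero_locus J b (S U))" using S(2) by auto
  also have "\<dots> = mproj_points J b - zero_locus J b (\<Union>U\<in>\<U>. S U)"
    unfolding zero_locus_def by blast
  finally show "?op (\<Union>\<U>)" using S(1) by (intro exI[of _ "\<Union>U\<in>\<U>. S U"]) blast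
qed

lemma openin_zariski:
  "openin (zariski J b) U \<longleftrightarrow>
     (\<exists>S \<subseteq> {F. \<exists>d. mhom J b d F}. U = mproj_points J b - zero_locus J b S)"
  unfolding zariski_def by (simp add: topology_inverse'[OF istopology_zariski])

lemma topspace_zariski: "topspace (zariski J b) = mproj_points J b"
proof -
  have "mproj_points J b = mproj_points J b - zero_locus J b {\<lambda>_. 1}"
    using mpoint_self by (fastforce simp: zero_locus_def mproj_points_def)
  then have "openin (zariski J b) (mproj_points J b)"
    unfolding openin_zariski by (intro exI[of _ "{\<lambda>_. 1}"]) (auto intro: mhom.const)
  then have "mproj_points J b \<subseteq> topspace (zariski J b)" by (rule openin_subset)
  moreover have "topspace (zariski J b) \<subseteq> mproj_points J b"
    using openin_topspace[of "zariski J b"] unfolding openin_zariski by blast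
  ultimately show ?thesis by blast
qed

lemma closedin_zariski:
  "closedin (zariski J b) Z \<longleftrightarrow> (\<exists>S \<subseteq> {F. \<exists>d. mhom J b d F}. Z = zero_locus J b S)"
proof -
  have "zero_locus J b S \<subseteq> mproj_points J b" for S by (auto simp: zero_locus_def)
  then show ?thesis unfolding closedin_def topspace_zariski openin_zariski by blast
qed

section \<open>Spaces with regular functions and closed embeddings\<close>

text \<open>
  A variety is regarded as a topological space together with, for each open set \<open>U\<close>, the set of
  regular functions on \<open>U\<close>. Such a function is represented by a total function whose values
  outside \<open>U\<close> are irrelevant.
\<close>

record 'x fspace =
  topo :: "'x topology"
  reg :: "'x set \<Rightarrow> ('x \<Rightarrow> complex) set"

definition mproj :: "'j set \<Rightarrow> ('j \<Rightarrow> 'k) \<Rightarrow> ('j \<Rightarrow> complex) set fspace" where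
  "mproj J b =
     \<lparr> topo = zariski J b,
       reg = (\<lambda>U. {f. \<forall>P \<in> U. \<exists>W d F G. openin (zariski J b) W \<and> P \<in> W \<and> W \<subseteq> U \<and>
                       mhom J b d F \<and> mhom J b d G \<and>
                       (\<forall>Q \<in> W. \<forall>x \<in> Q. G x \<noteq> 0 \<and> f Q = F x / G x)}) \<rparr>"

text \<open>
  The last condition says that \<open>X\<close> carries the structure of closed subvariety of \<open>Y\<close>: the
  regular functions are exactly those that locally extend to regular functions on \<open>Y\<close>.
\<close>

definition closed_embedding :: "'x fspace \<Rightarrow> 'y fspace \<Rightarrow> ('x \<Rightarrow> 'y) \<Rightarrow> bool" where
  "closed_embedding X Y \<phi> \<longleftrightarrow>
     embedding_map (topo X) (topo Y) \<phi> \<and>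
     closedin (topo Y) (\<phi> ` topspace (topo X)) \<and>
     (\<forall>U f. openin (topo X) U \<longrightarrow>
        (f \<in> reg X U \<longleftrightarrow>
          (\<forall>x \<in> U. \<exists>V g. openin (topo Y) V \<and> \<phi> x \<in> V \<and> g \<in> reg Y V \<and>
             (\<forall>y \<in> U. \<phi> y \<in> V \<longrightarrow> f y = g (\<phi> y)))))"

text \<open>Projective space with homogeneous coordinates indexed by the finite set \<open>I\<close>.\<close>

abbreviation blk :: "'i \<Rightarrow> unit" where "blk \<equiv> \<lambda>_. ()"

abbreviation proj_space :: "'i set \<Rightarrow> ('i \<Rightarrow> complex) set fspace" where
  "proj_space I \<equiv> mproj I blk"

text \<open>
  \<open>L\<close> is an invertible linear map of coordinate vectors, and the induced map of projective
  spaces (which sends the point \<open>P\<close> to \<open>L ` P\<close>) carries \<open>A\<close> onto \<open>B\<close>.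
\<close>

definition linear_iso_between ::
  "(('i \<Rightarrow> complex) \<Rightarrow> ('k \<Rightarrow> complex)) \<Rightarrow> 'i set \<Rightarrow> ('i \<Rightarrow> complex) set set \<Rightarrow>
   'k set \<Rightarrow> ('k \<Rightarrow> complex) set set \<Rightarrow> bool" where
  "linear_iso_between L I A K B \<longleftrightarrow>
     bij_betw L (vecs I) (vecs K) \<and>
     (\<forall>x \<in> vecs I. \<forall>y \<in> vecs I. L (\<lambda>i. x i + y i) = (\<lambda>k. L x k + L y k)) \<and>
     (\<forall>x \<in> vecs I. \<forall>c. L (\<lambda>i. c * x i) = (\<lambda>k. c * L x k)) \<and>
     (\<lambda>P. L ` P) ` A = B"

section \<open>The Parke--Taylor variety\<close>

definition Sig :: "nat \<Rightarrow> nat list set" where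
  "Sig n = {\<sigma>. distinct \<sigma> \<and> set \<sigma> = {1..n} \<and> \<sigma> ! 0 = 1 \<and> \<sigma> ! 1 = 2}"

definition plane_basis ::
  "nat \<Rightarrow> (nat \<Rightarrow> complex) set \<Rightarrow> (nat \<Rightarrow> complex) \<Rightarrow> (nat \<Rightarrow> complex) \<Rightarrow> bool" where
  "plane_basis n V u v \<longleftrightarrow>
     u \<in> vecs {1..n} \<and> v \<in> vecs {1..n} \<and>
     (\<forall>a b. (\<lambda>i. a * u i + b * v i) = (\<lambda>_. 0) \<longrightarrow> a = 0 \<and> b = 0) \<and>
     V = {(\<lambda>i. a * u i + b * v i) | a b. True}"

definition Gr2 :: "nat \<Rightarrow> (nat \<Rightarrow> complex) set set" where
  "Gr2 n = {V. \<exists>u v. plane_basis n V u v}"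

definition pluecker :: "(nat \<Rightarrow> complex) \<Rightarrow> (nat \<Rightarrow> complex) \<Rightarrow> nat \<Rightarrow> nat \<Rightarrow> complex" where
  "pluecker u v i j = u i * v j - u j * v i"

definition parke_taylor ::
  "nat \<Rightarrow> (nat \<Rightarrow> complex) \<Rightarrow> (nat \<Rightarrow> complex) \<Rightarrow> nat list \<Rightarrow> complex" where
  "parke_taylor n u v \<sigma> = (\<Prod>i<n. 1 / pluecker u v (\<sigma> ! i) (\<sigma> ! (Suc i mod n)))"

definition PT_vec ::
  "nat \<Rightarrow> (nat \<Rightarrow> complex) \<Rightarrow> (nat \<Rightarrow> complex) \<Rightarrow> nat list \<Rightarrow> complex" where
  "PT_vec n u v = (\<lambda>\<sigma>. if \<sigma> \<in> Sig n then parke_taylor n u v \<sigma> else 0)"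

text \<open>
  A change of basis of \<open>V\<close> rescales all Pluecker coordinates, hence also \<open>PT_vec\<close>, by a common
  factor, so the point below depends on \<open>V\<close> only.
\<close>

definition PT :: "nat \<Rightarrow> (nat list \<Rightarrow> complex) set set" where
  "PT n = zariski (Sig n) blk closure_of
     {mpoint blk (PT_vec n u v) | V u v.
        V \<in> Gr2 n \<and> plane_basis n V u v \<and>
        (\<forall>i \<in> {1..n}. \<forall>j \<in> {1..n}. i \<noteq> j \<longrightarrow> pluecker u v i j \<noteq> 0)}"

section \<open>The log canonical embedding\<close>

text \<open>
  Every \<open>n\<close>-tuple of distinct points of the projective line is projectively equivalent to
  one of affine points, so the set of points of \<open>M\<^sub>0\<^sub>,\<^sub>n\<close> is the quotient \<open>M0 n\<close>.
\<close>

definition config :: "nat \<Rightarrow> (nat \<Rightarrow> complex) set" where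
  "config n = {p. inj_on p {1..n}}"

definition moebius_rel :: "nat \<Rightarrow> ((nat \<Rightarrow> complex) \<times> (nat \<Rightarrow> complex)) set" where
  "moebius_rel n = {(p, q). p \<in> config n \<and> q \<in> config n \<and>
     (\<exists>a b c d. a * d - b * c \<noteq> 0 \<and>
        (\<forall>i \<in> {1..n}. c * p i + d \<noteq> 0 \<and> q i = (a * p i + b) / (c * p i + d)))}"

definition M0 :: "nat \<Rightarrow> (nat \<Rightarrow> complex) set set" where
  "M0 n = config n // moebius_rel n"

text \<open>Coordinate \<open>(m, i)\<close> is the \<open>i\<close>-th homogeneous coordinate of the \<open>m\<close>-th factor.\<close>

definition kap_coords :: "nat \<Rightarrow> (nat \<times> nat) set" where
  "kap_coords n = {(m, i). m \<in> {1..n-3} \<and> i \<in> {1..m+1}}"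

abbreviation kap_space :: "nat \<Rightarrow> (nat \<times> nat \<Rightarrow> complex) set fspace" where
  "kap_space n \<equiv> mproj (kap_coords n) fst"

definition kap_vec :: "nat \<Rightarrow> (nat \<Rightarrow> complex) \<Rightarrow> nat \<times> nat \<Rightarrow> complex" where
  "kap_vec n p = (\<lambda>(m, i). if (m, i) \<in> kap_coords n
                           then (p 1 - p (i+1)) / (p (m+3) - p (i+1)) else 0)"

text \<open>
  No construction of the moduli space of stable \<open>n\<close>-pointed rational curves is available.
  \<open>is_M0bar n X \<iota> \<Omega>\<close> characterizes it by two of its known properties: \<open>\<iota>\<close> is an inclusion of
  \<open>M\<^sub>0\<^sub>,\<^sub>n\<close> as a dense open subset, and \<open>\<Omega>\<close> is the iterated Kapranov embedding, a closed
  embedding given on \<open>M\<^sub>0\<^sub>,\<^sub>n\<close> by the explicit formula.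
  The image of \<open>\<Omega>\<close> is then the closure of the image of \<open>M\<^sub>0\<^sub>,\<^sub>n\<close>, and \<open>X\<close> has the structure of
  closed subvariety, so these data determine \<open>X\<close> up to a unique compatible isomorphism.
\<close>

definition is_M0bar ::
  "nat \<Rightarrow> 'x fspace \<Rightarrow> ((nat \<Rightarrow> complex) set \<Rightarrow> 'x) \<Rightarrow>
   ('x \<Rightarrow> (nat \<times> nat \<Rightarrow> complex) set) \<Rightarrow> bool" where
  "is_M0bar n X \<iota> \<Omega> \<longleftrightarrow>
     inj_on \<iota> (M0 n) \<and>
     openin (topo X) (\<iota> ` M0 n) \<and>
     topo X closure_of (\<iota> ` M0 n) = topspace (topo X) \<and>
     closed_embedding X (kap_space n) \<Omega> \<and>
     (\<forall>p \<in> config n. \<Omega> (\<iota> (moebius_rel n `` {p})) = mpoint fst (kap_vec n p))"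

definition lc_coords :: "nat \<Rightarrow> nat list set" where
  "lc_coords n = {I. length I = n - 3 \<and> (\<forall>m \<in> {1..n-3}. I ! (m-1) \<in> {1..m+1})}"

definition segre_vec :: "nat \<Rightarrow> (nat \<times> nat \<Rightarrow> complex) \<Rightarrow> nat list \<Rightarrow> complex" where
  "segre_vec n x = (\<lambda>I. if I \<in> lc_coords n then \<Prod>m\<in>{1..n-3}. x (m, I ! (m-1)) else 0)"

text \<open>
  As \<open>x\<close> runs through all coordinate vectors of a point of the product, \<open>segre_vec n x\<close> runs
  through all coordinate vectors of its image (there is at least one factor when \<open>n \<ge> 4\<close>).
\<close>

definition segre :: "nat \<Rightarrow> (nat \<times> nat \<Rightarrow> complex) set \<Rightarrow> (nat list \<Rightarrow> complex) set" where
  "segre n P = segre_vec n ` P"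

definition LC :: "nat \<Rightarrow> (nat list \<Rightarrow> complex) set set" where
  "LC n = zariski (lc_coords n) blk closure_of
     {segre n (mpoint fst (kap_vec n p)) | p. p \<in> config n}"

section \<open>The explicit isomorphism\<close>

definition right_of :: "nat list \<Rightarrow> nat \<Rightarrow> nat \<Rightarrow> bool" where
  "right_of \<tau> a c \<longleftrightarrow> (\<exists>i j. i < j \<and> j < length \<tau> \<and> \<tau> ! i = a \<and> \<tau> ! j = c)"

text \<open>The permutations indexing the sum \<open>Z\<^bsub>a,\<sigma>\<^esub>\<close>, for \<open>\<sigma> \<in> Sig (n-1)\<close>.\<close>

definition Z_index :: "nat \<Rightarrow> nat \<Rightarrow> nat list \<Rightarrow> nat list set" where
  "Z_index n a \<sigma> = {\<tau> \<in> Sig n. remove1 n \<tau> = \<sigma> \<and> right_of \<tau> a n}"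

definition Zform :: "nat \<Rightarrow> nat \<Rightarrow> nat list \<Rightarrow> (nat list \<Rightarrow> complex) \<Rightarrow> complex" where
  "Zform n a \<sigma> z = (\<Sum>\<tau> \<in> Z_index n a \<sigma>. z \<tau>)"

definition B5 :: "nat list \<Rightarrow> nat list set" where
  "B5 I =
    (if I = [1,1] then {[1,2,3,4,5], [1,2,3,5,4], [1,2,4,3,5], [1,2,4,5,3], [1,2,5,3,4], [1,2,5,4,3]}
     else if I = [1,2] then {[1,2,3,4,5], [1,2,3,5,4], [1,2,4,3,5]}
     else if I = [1,3] then {[1,2,3,4,5], [1,2,4,3,5], [1,2,4,5,3]}
     else if I = [2,1] then {[1,2,3,4,5], [1,2,3,5,4], [1,2,5,3,4]}
     else if I = [2,2] then {[1,2,3,4,5], [1,2,3,5,4]}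
     else if I = [2,3] then {[1,2,3,4,5]}
     else {})"

text \<open>
  The sets \<open>Z_index n a \<sigma>\<close> for distinct \<open>\<sigma>\<close> are disjoint, so the sum of \<open>Zform n a \<sigma>\<close> over
  \<open>\<sigma> \<in> S\<close> is the sum of the coordinates in the union below.
\<close>

function Bset :: "nat \<Rightarrow> nat list \<Rightarrow> nat list set" where
  "n \<le> 5 \<Longrightarrow> Bset n I = B5 I"
| "n \<ge> 6 \<Longrightarrow> Bset n I = (\<Union>\<sigma> \<in> Bset (n - 1) (butlast I). Z_index n (last I + 1) \<sigma>)"
  by (force, auto)
termination by (relation "Wellfounded.measure fst") auto

definition B_map :: "nat \<Rightarrow> (nat list \<Rightarrow> complex) \<Rightarrow> nat list \<Rightarrow> complex" where
  "B_map n z = (\<lambda>I. if I \<in> lc_coords n then \<Sum>\<tau> \<in> Bset n I. z \<tau> else 0)"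

definition BZ_map :: "nat \<Rightarrow> (nat list \<Rightarrow> complex) \<Rightarrow> nat list \<Rightarrow> complex" where
  "BZ_map n z = (\<lambda>I. if I \<in> lc_coords n
                     then \<Sum>\<sigma> \<in> Bset (n - 1) (butlast I). Zform n (last I + 1) \<sigma> z else 0)"

end

theory Submission
  imports Defs
begin

text \<open>
  The linear change of coordinates is built by induction on \<open>n\<close>. The recursion of the index sets
  extends downwards to \<open>n = 3\<close>, where both projective spaces are a single point. In the step, a
  permutation \<open>\<tau> \<in> Sig n\<close> is a permutation \<open>\<sigma> \<in> Sig (n - 1)\<close> together with a position for the
  letter \<open>n\<close>, and for fixed \<open>\<sigma>\<close> the forms \<open>Zform n a \<sigma>\<close> are the sums of the coordinates \<open>z \<tau>\<close> over
  the final segments of positions. Hence they form a triangular system, which together with the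
  induction hypothesis makes the change of coordinates \<open>form_map\<close> bijective (\<open>form_map_bij\<close>).

  On a Parke--Taylor function \<open>f\<close> with Pluecker coordinates \<open>q\<close>, the three-term Pluecker relation
  turns the sum over a final segment of insertion positions into a telescoping sum, and
  \<open>Zform n a \<sigma> f\<close> is \<open>q 1 a / (q n 1 * q n a)\<close> times the Parke--Taylor function of \<open>\<sigma>\<close> for \<open>n - 1\<close>
  (\<open>Zform_parke_taylor\<close>). By induction the linear form with index \<open>I\<close> takes, up to a factor
  independent of \<open>I\<close>, the value \<open>\<Prod>m. (p 1 - p (i + 1)) / (p (m + 3) - p (i + 1))\<close>, where \<open>p\<close> are
  affine coordinates of the points and \<open>i\<close> is the \<open>m\<close>-th entry of \<open>I\<close>; this is the Segre
  coordinate of the Kapranov point (\<open>form_map_PT_vec\<close>). So the linear map carries the points whose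
  closure is \<open>PT n\<close> onto those whose closure is \<open>LC n\<close>, and as a homeomorphism of projective
  spaces it carries \<open>PT n\<close> onto \<open>LC n\<close>.

  For the statements about the moduli space, the Segre map and linear isomorphisms are
  shown to be closed embeddings by a common criterion (\<open>closed_embedding_image\<close>): a polynomial map
  with closed image is a closed embedding if it has a polynomial inverse on each of a family of
  distinguished open sets that cover the image. Closed embeddings compose
  (\<open>closed_embedding_compose\<close>) and commute with closures (\<open>closed_embedding_closure\<close>).
\<close>

section \<open>Multihomogeneous coordinates\<close>

text \<open>The coordinate vectors representing points of a product of projective spaces.\<close>

definition mcoords :: "'j set \<Rightarrow> ('j \<Rightarrow> 'k) \<Rightarrow> ('j \<Rightarrow> complex) set" where
  "mcoords J b = {x \<in> vecs J. \<forall>k \<in> b ` J. \<exists>j \<in> J. b j = k \<and> x j \<noteq> 0}"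

lemma mproj_points_eq: "mproj_points J b = mpoint b ` mcoords J b"
  unfolding mproj_points_def mcoords_def by auto

lemma mpoint_eq:
  assumes "y \<in> mpoint b x"
  shows "mpoint b y = mpoint b x"
proof -
  obtain c where c: "\<And>k. c k \<noteq> 0" "y = (\<lambda>j. c (b j) * x j)"
    using assms unfolding mpoint_def by blast
  show ?thesis
  proof (intro equalityI subsetI)
    fix z assume "z \<in> mpoint b y"
    then obtain e where "\<And>k. e k \<noteq> 0" "z = (\<lambda>j. e (b j) * y j)"
      unfolding mpoint_def by blast
    then show "z \<in> mpoint b x" unfolding mpoint_def c(2)
      by (intro CollectI exI[of _ "\<lambda>k. e k * c k"]) (auto simp: c(1) mult.assoc)
  next
    fix z assume "z \<in> mpoint b x"
    then obtain e where "\<And>k. e k \<noteq> 0" "z = (\<lambda>j. e (b j) * x j)"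
      unfolding mpoint_def by blast
    then show "z \<in> mpoint b y" unfolding mpoint_def c(2)
      by (intro CollectI exI[of _ "\<lambda>k. e k / c k"]) (auto simp: c(1))
  qed
qed

lemma mcoords_mpoint:
  assumes "x \<in> mcoords J b" "y \<in> mpoint b x"
  shows "y \<in> mcoords J b"
proof -
  obtain c where c: "\<And>k. c k \<noteq> 0" "y = (\<lambda>j. c (b j) * x j)"
    using assms unfolding mpoint_def by blast
  show ?thesis using assms(1) c unfolding mcoords_def vecs_def by auto
qed

lemma mproj_points_mem:
  assumes "P \<in> mproj_points J b" "x \<in> P"
  shows "x \<in> mcoords J b" "P = mpoint b x"
  using assms mcoords_mpoint mpoint_eq unfolding mproj_points_eq by blast+

lemma mpoint_in_mproj_points: "x \<in> mcoords J b \<Longrightarrow> mpoint b x \<in> mproj_points J b"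
  unfolding mproj_points_eq by blast

lemma mproj_pointsE:
  assumes "P \<in> mproj_points J b"
  obtains x where "x \<in> P" "x \<in> mcoords J b" "P = mpoint b x"
  using assms mpoint_self unfolding mproj_points_eq by blast

text \<open>In a single projective space, a point is the set of nonzero multiples of a vector.\<close>

lemma mpoint_blk: "mpoint blk x = {y. \<exists>c. c \<noteq> 0 \<and> y = (\<lambda>j. c * x j)}"
  unfolding mpoint_def
proof (intro Collect_cong iffI)
  fix y assume "\<exists>c. (\<forall>k. c k \<noteq> 0) \<and> y = (\<lambda>j. c () * x j)"
  then show "\<exists>c. c \<noteq> 0 \<and> y = (\<lambda>j. c * x j)" by blast
next
  fix y assume "\<exists>c. c \<noteq> 0 \<and> y = (\<lambda>j. c * x j)"
  then obtain c where "c \<noteq> 0" "y = (\<lambda>j. c * x j)" by blast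
  then show "\<exists>c. (\<forall>k. c k \<noteq> 0) \<and> y = (\<lambda>j. c () * x j)" by (intro exI[of _ "\<lambda>_. c"]) auto
qed

lemma mhom_cmult: "mhom J b d F \<Longrightarrow> mhom J b d (\<lambda>x. a * F x)"
  using mhom.mult[OF mhom.const[of J b a], of d F] by simp

lemma mhom_diff: "mhom J b d F \<Longrightarrow> mhom J b d G \<Longrightarrow> mhom J b d (\<lambda>x. F x - G x)"
  using mhom.add[of J b d F "\<lambda>x. -1 * G x"] mhom_cmult[of J b d G "-1"] by simp

lemma mhom_sum:
  assumes "finite A" "A \<noteq> {}" "\<And>a. a \<in> A \<Longrightarrow> mhom J b d (F a)"
  shows "mhom J b d (\<lambda>x. \<Sum>a\<in>A. F a x)"
  using assms by (induction rule: finite_ne_induct) (auto intro: mhom.add)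

lemma mhom_prod:
  assumes "finite A" "\<And>a. a \<in> A \<Longrightarrow> mhom J b (d a) (F a)"
  shows "mhom J b (\<lambda>k. \<Sum>a\<in>A. d a k) (\<lambda>x. \<Prod>a\<in>A. F a x)"
  using assms by (induction rule: finite_induct) (auto intro: mhom.const mhom.mult)

text \<open>
  Substituting multihomogeneous polynomials into a multihomogeneous polynomial. The degree of the
  polynomial substituted for a coordinate may only depend on the block of the coordinate.
\<close>

lemma mhom_subst:
  assumes "mhom J b d F" and \<Phi>: "\<And>j. j \<in> J \<Longrightarrow> mhom J' b' (e (b j)) (\<lambda>x. \<Phi> x j)"
  shows "mhom J' b' (\<lambda>l. \<Sum>k | d k \<noteq> 0. d k * e k l) (\<lambda>x. F (\<Phi> x))"
  using assms(1)
proof (induction rule: mhom.induct)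
  case (const c)
  then show ?case using mhom.const[of J' b' c] by simp
next
  case (coord j)
  have "{k. (if k = b j then 1 else 0) \<noteq> (0::nat)} = {b j}" by auto
  then show ?case using \<Phi>[OF coord] by simp
next
  case (add d F G)
  show ?case using mhom.add[OF add.IH] .
next
  case (mult d F f G)
  let ?A = "{k. d k \<noteq> 0}" and ?B = "{k. f k \<noteq> 0}" and ?C = "{k. d k + f k \<noteq> 0}"
  have fin: "finite ?A" "finite ?B" using mult.hyps mhom_finite_degree by blast+
  have C: "?C = ?A \<union> ?B" by auto
  have "(\<Sum>k\<in>?C. d k * e k l) = (\<Sum>k\<in>?A. d k * e k l)"
    and "(\<Sum>k\<in>?C. f k * e k l) = (\<Sum>k\<in>?B. f k * e k l)" for l
    unfolding C by (rule sum.mono_neutral_right; use fin in auto)+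
  then have "(\<Sum>k\<in>?C. (d k + f k) * e k l) = (\<Sum>k\<in>?A. d k * e k l) + (\<Sum>k\<in>?B. f k * e k l)"
    for l by (simp add: distrib_right sum.distrib)
  then show ?case using mhom.mult[OF mult.IH] by simp
qed

text \<open>The distinguished open sets, on which a form has no zero.\<close>

lemma openin_nonvanishing:
  assumes "mhom J b d F"
  shows "openin (zariski J b) {P \<in> mproj_points J b. \<forall>x\<in>P. F x \<noteq> 0}"
proof -
  have "{P \<in> mproj_points J b. \<forall>x\<in>P. F x \<noteq> 0} = mproj_points J b - zero_locus J b {F}"
    (is "?L = ?R")
  proof (intro equalityI subsetI)
    fix P assume "P \<in> ?L"
    then show "P \<in> ?R" unfolding zero_locus_def by (auto elim!: mproj_pointsE)
  next
    fix P assume P: "P \<in> ?R"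
    then have P': "P \<in> mproj_points J b" by blast
    have "F y \<noteq> 0" if "y \<in> P" for y
      using P mproj_points_mem(2)[OF P' that] mhom_vanish_iff[OF assms, of y]
      by (auto simp: zero_locus_def)
    then show "P \<in> ?L" using P' by blast
  qed
  then show ?thesis unfolding openin_zariski using assms
    by (intro exI[of _ "{F}"]) auto
qed

text \<open>
  A quotient of two forms of the same degree is a function of the point, not of the vector.
\<close>

lemma mhom_ratio_cong:
  assumes "mhom J b d F" "mhom J b d G" "y \<in> mpoint b x"
  shows "F y / G y = F x / G x"
proof -
  obtain c where c: "\<And>k. c k \<noteq> 0" "y = (\<lambda>j. c (b j) * x j)"
    using assms unfolding mpoint_def by blast
  have "(\<Prod>k | d k \<noteq> 0. c k ^ d k) \<noteq> 0" using c(1) by (cases "finite {k. d k \<noteq> 0}") auto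
  then show ?thesis unfolding c(2) mhom_rescale[OF assms(1)] mhom_rescale[OF assms(2)] by simp
qed

section \<open>Closed embeddings\<close>

lemma topspace_mproj [simp]: "topspace (topo (mproj J b)) = mproj_points J b"
  by (simp add: mproj_def topspace_zariski)

lemma topo_mproj [simp]: "topo (mproj J b) = zariski J b"
  by (simp add: mproj_def)

lemma reg_mproj:
  "f \<in> reg (mproj J b) V \<longleftrightarrow>
     (\<forall>P \<in> V. \<exists>W d F G. openin (zariski J b) W \<and> P \<in> W \<and> W \<subseteq> V \<and>
        mhom J b d F \<and> mhom J b d G \<and> (\<forall>Q \<in> W. \<forall>x \<in> Q. G x \<noteq> 0 \<and> f Q = F x / G x))"
  unfolding mproj_def by simp

lemma reg_mproj_restrict:
  assumes f: "f \<in> reg (mproj J b) V" and W: "openin (zariski J b) W" "W \<subseteq> V"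
  shows "f \<in> reg (mproj J b) W"
  unfolding reg_mproj
proof
  fix P assume P: "P \<in> W"
  from bspec[OF f[unfolded reg_mproj] subsetD[OF W(2) P]]
  obtain W' d F G where W': "openin (zariski J b) W'" "P \<in> W'" "mhom J b d F" "mhom J b d G"
     "\<forall>Q \<in> W'. \<forall>x \<in> Q. G x \<noteq> 0 \<and> f Q = F x / G x"
    by (elim exE conjE)
  have "openin (zariski J b) (W' \<inter> W)" using W'(1) W(1) by (rule openin_Int)
  with W' P show "\<exists>W' d F G. openin (zariski J b) W' \<and> P \<in> W' \<and> W' \<subseteq> W \<and> mhom J b d F \<and>
      mhom J b d G \<and> (\<forall>Q \<in> W'. \<forall>x \<in> Q. G x \<noteq> 0 \<and> f Q = F x / G x)"
    by (intro exI[of _ "W' \<inter> W"] exI[of _ d] exI[of _ F] exI[of _ G]) auto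
qed

lemma embedding_imp_continuous_map: "embedding_map X Y f \<Longrightarrow> continuous_map X Y f"
  unfolding embedding_map_def
  using continuous_map_in_subtopology homeomorphic_imp_continuous_map by blast

lemma closed_embedding_embedding:
  "closed_embedding X Y \<phi> \<Longrightarrow> embedding_map (topo X) (topo Y) \<phi>"
  unfolding closed_embedding_def by (elim conjE)

lemma closed_embedding_closed:
  "closed_embedding X Y \<phi> \<Longrightarrow> closedin (topo Y) (\<phi> ` topspace (topo X))"
  unfolding closed_embedding_def by (elim conjE)

lemma closed_embedding_closure:
  assumes "closed_embedding X Y \<phi>" "S \<subseteq> topspace (topo X)"
  shows "\<phi> ` (topo X closure_of S) = topo Y closure_of (\<phi> ` S)"
proof -
  note closed_embedding_embedding[OF assms(1)] closed_embedding_closed[OF assms(1)]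
  then have "continuous_map (topo X) (topo Y) \<phi>" "closed_map (topo X) (topo Y) \<phi>"
    by (auto intro: embedding_imp_continuous_map embedding_imp_closed_map)
  then show ?thesis
    using assms(2) continuous_map_image_closure_subset[of "topo X" "topo Y" \<phi> S]
    unfolding closed_map_closure_of_image by blast
qed

lemma embedding_map_open_extension:
  assumes "embedding_map X Y f" "openin X U"
  obtains V where "openin Y V" "U = {x \<in> topspace X. f x \<in> V}"
proof -
  have "homeomorphic_map X (subtopology Y (f ` topspace X)) f"
    using assms(1) unfolding embedding_map_def .
  then have o: "openin (subtopology Y (f ` topspace X)) (f ` U)" and i: "inj_on f (topspace X)"
    using assms(2) openin_subset[OF assms(2)] homeomorphic_imp_injective_map
    by (fastforce simp: homeomorphic_map_openness)+
  obtain V where V: "openin Y V" "f ` U = V \<inter> f ` topspace X"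
    using o unfolding openin_subtopology by blast
  have "U = {x \<in> topspace X. f x \<in> V}"
    using V(2) i openin_subset[OF assms(2)] unfolding inj_on_def by blast
  then show thesis using V(1) that by blast
qed

lemma closed_embedding_reg:
  assumes "closed_embedding X Y \<phi>"
  shows "openin (topo X) U \<Longrightarrow> f \<in> reg X U \<longleftrightarrow>
     (\<forall>x \<in> U. \<exists>V g. openin (topo Y) V \<and> \<phi> x \<in> V \<and> g \<in> reg Y V \<and>
        (\<forall>y \<in> U. \<phi> y \<in> V \<longrightarrow> f y = g (\<phi> y)))"
proof -
  have "\<forall>U f. openin (topo X) U \<longrightarrow> (f \<in> reg X U \<longleftrightarrow>
     (\<forall>x \<in> U. \<exists>V g. openin (topo Y) V \<and> \<phi> x \<in> V \<and> g \<in> reg Y V \<and>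
        (\<forall>y \<in> U. \<phi> y \<in> V \<longrightarrow> f y = g (\<phi> y))))"
    using assms unfolding closed_embedding_def by (elim conjE)
  then show "openin (topo X) U \<Longrightarrow> f \<in> reg X U \<longleftrightarrow>
     (\<forall>x \<in> U. \<exists>V g. openin (topo Y) V \<and> \<phi> x \<in> V \<and> g \<in> reg Y V \<and>
        (\<forall>y \<in> U. \<phi> y \<in> V \<longrightarrow> f y = g (\<phi> y)))"
    by (elim allE impE)
qed

text \<open>
  A regular function on an open \<open>U\<close> of \<open>X\<close> extends locally to \<open>Y\<close>, and such an extension extends
  locally to the ambient space of \<open>Y\<close>. The second extension has to be restricted to an open set
  meeting \<open>Y\<close> in the domain of the first one, so that both are comparable on all of \<open>U\<close>; this is
  where restriction of regular functions on the ambient space enters.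
\<close>

lemma closed_embedding_compose:
  assumes \<phi>: "closed_embedding X Y \<phi>" and \<psi>: "closed_embedding Y (mproj J b) \<psi>"
  shows "closed_embedding X (mproj J b) (\<psi> \<circ> \<phi>)"
proof -
  let ?Z = "mproj J b"
  have e: "embedding_map (topo X) (topo Y) \<phi>" "embedding_map (topo Y) (topo ?Z) \<psi>"
    and c: "closedin (topo Y) (\<phi> ` topspace (topo X))"
      "closedin (topo ?Z) (\<psi> ` topspace (topo Y))"
    using assms by (simp_all only: closed_embedding_embedding closed_embedding_closed)
  note regX = closed_embedding_reg[OF \<phi>] and regY = closed_embedding_reg[OF \<psi>]
  have im: "\<phi> x \<in> topspace (topo Y)" if "x \<in> topspace (topo X)" for x
    using c(1) closedin_subset that by blast
  have "f \<in> reg X U \<longleftrightarrow>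
          (\<forall>x \<in> U. \<exists>V g. openin (topo ?Z) V \<and> (\<psi> \<circ> \<phi>) x \<in> V \<and> g \<in> reg ?Z V \<and>
             (\<forall>y \<in> U. (\<psi> \<circ> \<phi>) y \<in> V \<longrightarrow> f y = g ((\<psi> \<circ> \<phi>) y)))" (is "_ \<longleftrightarrow> ?R")
    if U: "openin (topo X) U" for U f
  proof
    assume f: "f \<in> reg X U"
    show ?R
    proof
      fix x assume x: "x \<in> U"
      from bspec[OF iffD1[OF regX[OF U] f] x]
      obtain V g where V: "openin (topo Y) V" "\<phi> x \<in> V" "g \<in> reg Y V"
        "\<forall>y \<in> U. \<phi> y \<in> V \<longrightarrow> f y = g (\<phi> y)"
        by (elim exE conjE)
      from bspec[OF iffD1[OF regY[OF V(1)] V(3)] V(2)]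
      obtain W h where W: "openin (topo ?Z) W" "\<psi> (\<phi> x) \<in> W" "h \<in> reg ?Z W"
        "\<forall>y \<in> V. \<psi> y \<in> W \<longrightarrow> g y = h (\<psi> y)"
        by (elim exE conjE)
      obtain W' where W': "openin (topo ?Z) W'" "V = {y \<in> topspace (topo Y). \<psi> y \<in> W'}"
        using embedding_map_open_extension[OF e(2) V(1)] by blast
      have o: "openin (topo ?Z) (W \<inter> W')" using W(1) W'(1) by (rule openin_Int)
      moreover have "(\<psi> \<circ> \<phi>) x \<in> W \<inter> W'" using W(2) V(2) W'(2) by auto
      moreover have "h \<in> reg ?Z (W \<inter> W')"
        using reg_mproj_restrict[OF W(3)] o by simp
      moreover have "f y = h ((\<psi> \<circ> \<phi>) y)"
        if "y \<in> U" "(\<psi> \<circ> \<phi>) y \<in> W \<inter> W'" for y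
      proof -
        have "\<phi> y \<in> V" using that W'(2) im openin_subset[OF U] by auto
        then show ?thesis using V(4) W(4) that by auto
      qed
      ultimately show "\<exists>V g. openin (topo ?Z) V \<and> (\<psi> \<circ> \<phi>) x \<in> V \<and> g \<in> reg ?Z V \<and>
             (\<forall>y \<in> U. (\<psi> \<circ> \<phi>) y \<in> V \<longrightarrow> f y = g ((\<psi> \<circ> \<phi>) y))"
        by (intro exI[of _ "W \<inter> W'"] exI[of _ h]) simp
    qed
  next
    assume R: ?R
    have "\<exists>V g. openin (topo Y) V \<and> \<phi> x \<in> V \<and> g \<in> reg Y V \<and>
             (\<forall>y \<in> U. \<phi> y \<in> V \<longrightarrow> f y = g (\<phi> y))" if x: "x \<in> U" for x
    proof -
      from bspec[OF R x]
      obtain W h where W: "openin (topo ?Z) W" "\<psi> (\<phi> x) \<in> W" "h \<in> reg ?Z W"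
        "\<forall>y \<in> U. \<psi> (\<phi> y) \<in> W \<longrightarrow> f y = h (\<psi> (\<phi> y))"
        unfolding comp_apply by (elim exE conjE)
      let ?V = "{y \<in> topspace (topo Y). \<psi> y \<in> W}"
      have V: "openin (topo Y) ?V"
        using embedding_imp_continuous_map[OF e(2)] W(1) by (rule openin_continuous_map_preimage)
      have "h \<circ> \<psi> \<in> reg Y ?V"
        unfolding regY[OF V]
      proof
        fix y assume "y \<in> ?V"
        then show "\<exists>V g. openin (topo ?Z) V \<and> \<psi> y \<in> V \<and> g \<in> reg ?Z V \<and>
            (\<forall>y\<in>?V. \<psi> y \<in> V \<longrightarrow> (h \<circ> \<psi>) y = g (\<psi> y))"
          using W(1,3) by (intro exI[of _ W] exI[of _ h]) simp
      qed
      moreover have "\<phi> x \<in> ?V" using W(2) x im openin_subset[OF U] by auto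
      ultimately show ?thesis
        using V W(4) by (intro exI[of _ ?V] exI[of _ "h \<circ> \<psi>"]) simp
    qed
    then show "f \<in> reg X U" unfolding regX[OF U] by (rule ballI)
  qed
  moreover have "embedding_map (topo X) (topo ?Z) (\<psi> \<circ> \<phi>)"
    using e by (rule embedding_map_compose)
  moreover have "closedin (topo ?Z) ((\<psi> \<circ> \<phi>) ` topspace (topo X))"
    using embedding_imp_closed_map[OF e(2) c(2)] c(1) unfolding closed_map_def image_comp[symmetric]
    by blast
  ultimately show ?thesis unfolding closed_embedding_def by (intro conjI allI impI)
qed

text \<open>
  A multihomogeneous polynomial map \<open>\<Phi>\<close> which has closed image and which is inverted, on the
  nonvanishing locus of each of a covering family of forms \<open>D c\<close>, by a multihomogeneous
  polynomial map \<open>\<Psi> c\<close>, is a closed embedding. The degrees of the components of \<open>\<Phi>\<close> are given by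
  \<open>e\<close> and those of \<open>\<Psi> c\<close> by \<open>h c\<close>. As a point is the set of its coordinate vectors, the map of
  points is the image map of \<open>\<Phi>\<close>.
\<close>

locale chartwise_inverse =
  fixes J :: "'j set" and b :: "'j \<Rightarrow> 'k" and J' :: "'i set" and b' :: "'i \<Rightarrow> 'l"
    and \<Phi> :: "('j \<Rightarrow> complex) \<Rightarrow> 'i \<Rightarrow> complex"
    and e :: "'l \<Rightarrow> 'k \<Rightarrow> nat"
    and C :: "'c set"
    and D :: "'c \<Rightarrow> ('i \<Rightarrow> complex) \<Rightarrow> complex"
    and \<Psi> :: "'c \<Rightarrow> ('i \<Rightarrow> complex) \<Rightarrow> 'j \<Rightarrow> complex"
    and h :: "'c \<Rightarrow> 'k \<Rightarrow> 'l \<Rightarrow> nat"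
  assumes Phi_hom: "i \<in> J' \<Longrightarrow> mhom J b (e (b' i)) (\<lambda>x. \<Phi> x i)"
    and Phi_coords: "x \<in> mcoords J b \<Longrightarrow> \<Phi> x \<in> mcoords J' b'"
    and Phi_point: "x \<in> mcoords J b \<Longrightarrow> \<Phi> ` mpoint b x = mpoint b' (\<Phi> x)"
    and D_hom: "c \<in> C \<Longrightarrow> \<exists>d. mhom J' b' d (D c)"
    and Psi_hom: "c \<in> C \<Longrightarrow> j \<in> J \<Longrightarrow> mhom J' b' (h c (b j)) (\<lambda>y. \<Psi> c y j)"
    and charts_cover: "x \<in> mcoords J b \<Longrightarrow> \<exists>c\<in>C. D c (\<Phi> x) \<noteq> 0"
    and Psi_Phi: "c \<in> C \<Longrightarrow> x \<in> mcoords J b \<Longrightarrow> D c (\<Phi> x) \<noteq> 0 \<Longrightarrow> \<Psi> c (\<Phi> x) \<in> mpoint b x"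
    and closed_image: "closedin (zariski J' b') ((`) \<Phi> ` mproj_points J b)"
begin

lemma image_point: "P \<in> mproj_points J b \<Longrightarrow> x \<in> P \<Longrightarrow> \<Phi> ` P = mpoint b' (\<Phi> x)"
  using mproj_points_mem Phi_point by metis

lemma image_in_mproj_points: "P \<in> mproj_points J b \<Longrightarrow> \<Phi> ` P \<in> mproj_points J' b'"
  by (metis Phi_coords image_point mproj_pointsE mpoint_in_mproj_points)

lemma Psi_Phi_mem:
  assumes "c \<in> C" "P \<in> mproj_points J b" "x \<in> P" "D c (\<Phi> x) \<noteq> 0"
  shows "\<Psi> c (\<Phi> x) \<in> P"
  using Psi_Phi assms mproj_points_mem by metis

lemma vanish_on_point:
  assumes "mhom J b d F" "P \<in> mproj_points J b" "x \<in> P" "y \<in> P"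
  shows "F x = 0 \<longleftrightarrow> F y = 0"
  using mhom_vanish_iff[OF assms(1)] mproj_points_mem(2)[OF assms(2)] assms(3,4) by metis

lemma inj_image: "inj_on ((`) \<Phi>) (mproj_points J b)"
proof (rule inj_onI)
  fix P Q assume P: "P \<in> mproj_points J b" and Q: "Q \<in> mproj_points J b" and eq: "\<Phi> ` P = \<Phi> ` Q"
  obtain x where x: "x \<in> P" "x \<in> mcoords J b" using P by (rule mproj_pointsE)
  \<comment> \<open>Equality of the images as sets of vectors yields representatives with equal images, and a
    local inverse recovers a common vector of \<open>P\<close> and \<open>Q\<close> from their image.\<close>
  obtain y where y: "y \<in> Q" "\<Phi> x = \<Phi> y" using eq x(1) by (metis imageE imageI)
  obtain c where c: "c \<in> C" "D c (\<Phi> x) \<noteq> 0" using charts_cover x(2) by blast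
  have "\<Psi> c (\<Phi> x) \<in> P" "\<Psi> c (\<Phi> x) \<in> Q"
    using Psi_Phi_mem c P Q x y by metis+
  then show "P = Q" using mproj_points_mem(2) P Q by metis
qed

lemma hom_pullback:
  assumes "mhom J' b' d F"
  shows "mhom J b (\<lambda>k. \<Sum>l | d l \<noteq> 0. d l * e l k) (\<lambda>x. F (\<Phi> x))"
  using assms Phi_hom by (rule mhom_subst)

lemma hom_pullback_inverse:
  assumes "mhom J b d F" "c \<in> C"
  shows "mhom J' b' (\<lambda>l. \<Sum>k | d k \<noteq> 0. d k * h c k l) (\<lambda>y. F (\<Psi> c y))"
  using assms(1) Psi_hom[OF assms(2)] by (rule mhom_subst)

lemma continuous_image: "continuous_map (zariski J b) (zariski J' b') ((`) \<Phi>)"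
  unfolding continuous_map_closedin topspace_zariski
proof (intro conjI allI impI)
  show "(`) \<Phi> \<in> mproj_points J b \<rightarrow> mproj_points J' b'" using image_in_mproj_points by blast
next
  fix Z assume "closedin (zariski J' b') Z"
  then obtain S where S: "S \<subseteq> {F. \<exists>d. mhom J' b' d F}" "Z = zero_locus J' b' S"
    unfolding closedin_zariski by blast
  let ?S = "(\<lambda>F x. F (\<Phi> x)) ` S"
  have "{P \<in> mproj_points J b. \<Phi> ` P \<in> Z} = zero_locus J b ?S"
    using image_in_mproj_points unfolding S(2) zero_locus_def by auto
  moreover have "?S \<subseteq> {F. \<exists>d. mhom J b d F}" using S(1) hom_pullback by blast
  ultimately show "closedin (zariski J b) {P \<in> mproj_points J b. \<Phi> ` P \<in> Z}"
    unfolding closedin_zariski by blast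
qed

text \<open>
  If \<open>Z\<close> is cut out by forms \<open>F\<close>, its image is cut out inside the closed image of \<open>\<Phi>\<close> by the forms
  \<open>F \<circ> \<Psi> c\<close>, multiplied by \<open>D c\<close> because \<open>\<Psi> c\<close> is an inverse only where \<open>D c\<close> does not vanish.
\<close>

lemma closed_map_image: "closed_map (zariski J b) (zariski J' b') ((`) \<Phi>)"
  unfolding closed_map_def
proof (intro allI impI)
  fix Z assume "closedin (zariski J b) Z"
  then obtain S where S: "S \<subseteq> {F. \<exists>d. mhom J b d F}" "Z = zero_locus J b S"
    unfolding closedin_zariski by blast
  let ?S = "{\<lambda>y. D c y * F (\<Psi> c y) | c F. c \<in> C \<and> F \<in> S}"
  have hom: "?S \<subseteq> {F. \<exists>d. mhom J' b' d F}"
  proof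
    fix G assume "G \<in> ?S"
    then obtain c F where cF: "c \<in> C" "F \<in> S" "G = (\<lambda>y. D c y * F (\<Psi> c y))" by blast
    then obtain d d' where "mhom J b d F" "mhom J' b' d' (D c)" using S(1) D_hom by blast
    then show "G \<in> {F. \<exists>d. mhom J' b' d F}"
      using mhom.mult hom_pullback_inverse cF(1) unfolding cF(3) by blast
  qed
  have "(`) \<Phi> ` Z = (`) \<Phi> ` mproj_points J b \<inter> zero_locus J' b' ?S"
  proof (intro equalityI subsetI)
    fix R assume "R \<in> (`) \<Phi> ` Z"
    then obtain P where P: "P \<in> mproj_points J b" "\<And>F x. F \<in> S \<Longrightarrow> x \<in> P \<Longrightarrow> F x = 0" "R = \<Phi> ` P"
      unfolding S(2) zero_locus_def by blast
    have "D c (\<Phi> x) * F (\<Psi> c (\<Phi> x)) = 0" if "c \<in> C" "F \<in> S" "x \<in> P" for c F x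
      using P(2)[OF that(2)] Psi_Phi_mem[OF that(1) P(1) that(3)] by auto
    then show "R \<in> (`) \<Phi> ` mproj_points J b \<inter> zero_locus J' b' ?S"
      using P(1,3) image_in_mproj_points unfolding zero_locus_def by auto
  next
    fix R assume R: "R \<in> (`) \<Phi> ` mproj_points J b \<inter> zero_locus J' b' ?S"
    then obtain P where P: "P \<in> mproj_points J b" "R = \<Phi> ` P" by blast
    have "F x = 0" if F: "F \<in> S" and x: "x \<in> P" for F x
    proof -
      obtain c where c: "c \<in> C" "D c (\<Phi> x) \<noteq> 0"
        using charts_cover mproj_points_mem(1)[OF P(1) x] by blast
      have "(\<lambda>y. D c y * F (\<Psi> c y)) \<in> ?S" using c(1) F by blast
      then have "D c (\<Phi> x) * F (\<Psi> c (\<Phi> x)) = 0"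
        using R x unfolding P(2) zero_locus_def by fast
      then have "F (\<Psi> c (\<Phi> x)) = 0" using c(2) by simp
      then show ?thesis
        using vanish_on_point[OF _ P(1) x Psi_Phi_mem[OF c(1) P(1) x c(2)]] S(1) F by blast
    qed
    then have "P \<in> Z" unfolding S(2) zero_locus_def using P(1) by blast
    then show "R \<in> (`) \<Phi> ` Z" using P(2) by blast
  qed
  moreover have "closedin (zariski J' b') (zero_locus J' b' ?S)"
    using hom unfolding closedin_zariski by blast
  ultimately show "closedin (zariski J' b') ((`) \<Phi> ` Z)" using closed_image by auto
qed

lemma embedding_image: "embedding_map (zariski J b) (zariski J' b') ((`) \<Phi>)"
  using continuous_image closed_map_image inj_image
  by (intro injective_closed_imp_embedding_map) (simp_all add: topspace_zariski)

text \<open>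
  A quotient \<open>F / G\<close> on the source extends to the quotient \<open>(F \<circ> \<Psi> c) / (G \<circ> \<Psi> c)\<close> on the target,
  where \<open>D c\<close> is nonzero.
\<close>

lemma reg_extends:
  assumes U: "openin (zariski J b) U" and f: "f \<in> reg (mproj J b) U" and P: "P \<in> U"
  shows "\<exists>V g. openin (zariski J' b') V \<and> \<Phi> ` P \<in> V \<and> g \<in> reg (mproj J' b') V \<and>
    (\<forall>Q\<in>U. \<Phi> ` Q \<in> V \<longrightarrow> f Q = g (\<Phi> ` Q))"
proof -
  have Upts: "U \<subseteq> mproj_points J b" using openin_subset[OF U] by (simp add: topspace_zariski)
  from bspec[OF f[unfolded reg_mproj] P]
  obtain W d F G where W: "openin (zariski J b) W" "P \<in> W" "W \<subseteq> U"
    and FG: "mhom J b d F" "mhom J b d G"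
    and fW: "\<forall>Q \<in> W. \<forall>x \<in> Q. G x \<noteq> 0 \<and> f Q = F x / G x"
    by (elim exE conjE)
  obtain x where x: "x \<in> P" "x \<in> mcoords J b" using P Upts mproj_pointsE by blast
  obtain c where c: "c \<in> C" "D c (\<Phi> x) \<noteq> 0" using charts_cover x(2) by blast
  obtain dD where dD: "mhom J' b' dD (D c)" using D_hom c(1) by blast
  obtain V0 where V0: "openin (zariski J' b') V0"
    "W = {Q \<in> topspace (zariski J b). \<Phi> ` Q \<in> V0}"
    using embedding_map_open_extension[OF embedding_image W(1)] by blast
  let ?F = "\<lambda>y. F (\<Psi> c y)" and ?G = "\<lambda>y. G (\<Psi> c y)"
  let ?V1 = "{R \<in> mproj_points J' b'. \<forall>y\<in>R. D c y \<noteq> 0}"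
  let ?V2 = "{R \<in> mproj_points J' b'. \<forall>y\<in>R. ?G y \<noteq> 0}"
  let ?V = "V0 \<inter> (?V1 \<inter> ?V2)"
  let ?d = "\<lambda>l. \<Sum>k | d k \<noteq> 0. d k * h c k l"
  let ?g = "\<lambda>R. ?F (SOME y. y \<in> R) / ?G (SOME y. y \<in> R)"
  note hom = hom_pullback_inverse[OF FG(1) c(1)] hom_pullback_inverse[OF FG(2) c(1)]
  have V: "openin (zariski J' b') ?V"
    using V0(1) openin_nonvanishing[OF dD] openin_nonvanishing[OF hom(2)]
    by (intro openin_Int)
  have nz: "\<forall>y\<in>\<Phi> ` P. K y \<noteq> 0" if "mhom J' b' dK K" "K (\<Phi> x) \<noteq> 0" for K dK
  proof
    fix y assume y: "y \<in> \<Phi> ` P"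
    then have y': "\<Phi> ` P = mpoint b' y"
      using mproj_points_mem(2) image_in_mproj_points P Upts by blast
    have "\<Phi> x \<in> \<Phi> ` P" using x(1) by blast
    then show "K y \<noteq> 0" using mhom_vanish_iff[OF that(1), of y] that(2) unfolding y' by blast
  qed
  have "\<Psi> c (\<Phi> x) \<in> P" using Psi_Phi_mem c P Upts x(1) by blast
  then have "?G (\<Phi> x) \<noteq> 0" using fW W(2) by blast
  then have "\<Phi> ` P \<in> ?V"
    using nz[OF hom(2)] nz[OF dD c(2)] image_in_mproj_points P Upts V0(2) W(2) by blast
  moreover have "?g \<in> reg (mproj J' b') ?V"
    unfolding reg_mproj
  proof
    fix R assume R: "R \<in> ?V"
    have g: "?G y \<noteq> 0 \<and> ?g Q = ?F y / ?G y" if "Q \<in> ?V" "y \<in> Q" for Q y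
    proof
      show "?G y \<noteq> 0" using that by blast
      have Q: "Q = mpoint b' y" using mproj_points_mem(2) that by blast
      have "(SOME z. z \<in> Q) \<in> Q" using that(2) by (rule someI[where P = "\<lambda>z. z \<in> Q"])
      then have "(SOME z. z \<in> Q) \<in> mpoint b' y" using Q by simp
      then show "?g Q = ?F y / ?G y" using mhom_ratio_cong[OF hom] by blast
    qed
    show "\<exists>W d F G. openin (zariski J' b') W \<and> R \<in> W \<and> W \<subseteq> ?V \<and>
        mhom J' b' d F \<and> mhom J' b' d G \<and>
        (\<forall>Q \<in> W. \<forall>x \<in> Q. G x \<noteq> 0 \<and> ?g Q = F x / G x)"
      by (rule exI[of _ ?V], rule exI[of _ ?d], rule exI[of _ ?F], rule exI[of _ ?G])
        (intro V R subset_refl hom ballI g conjI)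
  qed
  moreover have "f Q = ?g (\<Phi> ` Q)" if Q: "Q \<in> U" "\<Phi> ` Q \<in> ?V" for Q
  proof -
    have Qp: "Q \<in> mproj_points J b" using Q(1) Upts by blast
    have QW: "Q \<in> W" using Q(2) Qp unfolding V0(2) by (simp add: topspace_zariski)
    obtain z where z: "z \<in> Q" using Qp mproj_pointsE by blast
    then have "\<exists>y. y \<in> \<Phi> ` Q" by blast
    then have "(SOME y. y \<in> \<Phi> ` Q) \<in> \<Phi> ` Q"
      by (rule someI_ex[where P = "\<lambda>y. y \<in> \<Phi> ` Q"])
    then obtain w where w: "w \<in> Q" "(SOME y. y \<in> \<Phi> ` Q) = \<Phi> w" by blast
    have "D c (\<Phi> w) \<noteq> 0" using Q(2) w(1) by blast
    then have "\<Psi> c (\<Phi> w) \<in> Q" using Psi_Phi_mem[OF c(1) Qp w(1)] by blast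
    then show ?thesis unfolding w(2) using fW QW by blast
  qed
  ultimately show ?thesis using V by (intro exI[of _ ?V] exI[of _ ?g]) (intro conjI ballI impI)
qed

lemma reg_of_extension:
  assumes U: "openin (zariski J b) U"
    and ext: "\<forall>P\<in>U. \<exists>V g. openin (zariski J' b') V \<and> \<Phi> ` P \<in> V \<and> g \<in> reg (mproj J' b') V \<and>
      (\<forall>Q\<in>U. \<Phi> ` Q \<in> V \<longrightarrow> f Q = g (\<Phi> ` Q))"
  shows "f \<in> reg (mproj J b) U"
  unfolding reg_mproj
proof
  fix P assume P: "P \<in> U"
  have Upts: "U \<subseteq> mproj_points J b" using openin_subset[OF U] by (simp add: topspace_zariski)
  from bspec[OF ext P]
  obtain V g where V: "openin (zariski J' b') V" "\<Phi> ` P \<in> V" "g \<in> reg (mproj J' b') V"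
    and fg: "\<forall>Q\<in>U. \<Phi> ` Q \<in> V \<longrightarrow> f Q = g (\<Phi> ` Q)"
    by (elim exE conjE)
  from bspec[OF V(3)[unfolded reg_mproj] V(2)]
  obtain W d F G where W: "openin (zariski J' b') W" "\<Phi> ` P \<in> W" "W \<subseteq> V"
    and FG: "mhom J' b' d F" "mhom J' b' d G"
    and gW: "\<forall>Q \<in> W. \<forall>x \<in> Q. G x \<noteq> 0 \<and> g Q = F x / G x"
    by (elim exE conjE)
  let ?W = "{Q \<in> topspace (zariski J b). \<Phi> ` Q \<in> W} \<inter> U"
  have "openin (zariski J b) ?W"
    using openin_continuous_map_preimage[OF continuous_image W(1)] U by (rule openin_Int)
  moreover have "P \<in> ?W" using P Upts W(2) by (auto simp: topspace_zariski)
  moreover have "\<forall>Q \<in> ?W. \<forall>x \<in> Q. G (\<Phi> x) \<noteq> 0 \<and> f Q = F (\<Phi> x) / G (\<Phi> x)"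
    using fg gW W(3) by auto
  ultimately show "\<exists>W d F G. openin (zariski J b) W \<and> P \<in> W \<and> W \<subseteq> U \<and>
        mhom J b d F \<and> mhom J b d G \<and>
        (\<forall>Q \<in> W. \<forall>x \<in> Q. G x \<noteq> 0 \<and> f Q = F x / G x)"
    using hom_pullback[OF FG(1)] hom_pullback[OF FG(2)]
    by (intro exI[of _ ?W] exI[of _ "\<lambda>x. F (\<Phi> x)"] exI[of _ "\<lambda>x. G (\<Phi> x)"] exI conjI) simp_all
qed

theorem closed_embedding_image: "closed_embedding (mproj J b) (mproj J' b') ((`) \<Phi>)"
  unfolding closed_embedding_def topo_mproj topspace_zariski
  using embedding_image closed_image reg_extends reg_of_extension
  by (intro conjI allI impI iffI ballI) (simp_all add: topspace_zariski)

end

lemma closed_embedding_cong: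
  assumes \<phi>: "closed_embedding X Y \<phi>" and eq: "\<And>x. x \<in> topspace (topo X) \<Longrightarrow> \<phi> x = \<psi> x"
  shows "closed_embedding X Y \<psi>"
proof -
  have im: "\<phi> ` topspace (topo X) = \<psi> ` topspace (topo X)" using eq by (rule image_cong[OF refl])
  have "f \<in> reg X U \<longleftrightarrow>
          (\<forall>x \<in> U. \<exists>V g. openin (topo Y) V \<and> \<psi> x \<in> V \<and> g \<in> reg Y V \<and>
             (\<forall>y \<in> U. \<psi> y \<in> V \<longrightarrow> f y = g (\<psi> y)))"
    if U: "openin (topo X) U" for U f
  proof -
    have e: "\<psi> x = \<phi> x" if "x \<in> U" for x using eq openin_subset[OF U] that by fastforce
    have "f \<in> reg X U \<longleftrightarrow>
          (\<forall>x \<in> U. \<exists>V g. openin (topo Y) V \<and> \<phi> x \<in> V \<and> g \<in> reg Y V \<and>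
             (\<forall>y \<in> U. \<phi> y \<in> V \<longrightarrow> f y = g (\<phi> y)))"
      using U by (rule closed_embedding_reg[OF \<phi>])
    then show ?thesis using e by (simp cong: ball_cong)
  qed
  moreover have "embedding_map (topo X) (topo Y) \<psi>"
    using closed_embedding_embedding[OF \<phi>] eq by (rule embedding_map_eq)
  moreover have "closedin (topo Y) (\<psi> ` topspace (topo X))"
    using closed_embedding_closed[OF \<phi>] unfolding im .
  ultimately show ?thesis unfolding closed_embedding_def by (intro conjI allI impI)
qed

section \<open>Linear isomorphisms\<close>

text \<open>The standard basis vectors.\<close>

definition unit_vec :: "'i \<Rightarrow> 'i \<Rightarrow> complex" where
  "unit_vec i = (\<lambda>j. if j = i then 1 else 0)"

text \<open>
  \<open>L\<close> is linear on the coordinate vectors. Nothing is said about vectors outside \<open>vecs I\<close>.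
\<close>

definition coords_linear ::
  "(('i \<Rightarrow> complex) \<Rightarrow> ('k \<Rightarrow> complex)) \<Rightarrow> 'i set \<Rightarrow> 'k set \<Rightarrow> bool" where
  "coords_linear L I K \<longleftrightarrow>
     (\<forall>x \<in> vecs I. L x \<in> vecs K) \<and>
     (\<forall>x \<in> vecs I. \<forall>y \<in> vecs I. L (\<lambda>i. x i + y i) = (\<lambda>k. L x k + L y k)) \<and>
     (\<forall>x \<in> vecs I. \<forall>c. L (\<lambda>i. c * x i) = (\<lambda>k. c * L x k))"

lemma coords_linear_vecs: "coords_linear L I K \<Longrightarrow> x \<in> vecs I \<Longrightarrow> L x \<in> vecs K"
  and coords_linear_add: "coords_linear L I K \<Longrightarrow> x \<in> vecs I \<Longrightarrow> y \<in> vecs I \<Longrightarrow>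
      L (\<lambda>i. x i + y i) = (\<lambda>k. L x k + L y k)"
  and coords_linear_scale: "coords_linear L I K \<Longrightarrow> x \<in> vecs I \<Longrightarrow>
      L (\<lambda>i. c * x i) = (\<lambda>k. c * L x k)"
  unfolding coords_linear_def by simp_all

lemma coords_linear_zero: "coords_linear L I K \<Longrightarrow> L (\<lambda>_. 0) = (\<lambda>_. 0)"
  using coords_linear_scale[of L I K "\<lambda>_. 0" 0] by (simp add: vecs_def)

lemma mhom_linear_form:
  assumes "finite I" "I \<noteq> {}"
  shows "mhom I blk (\<lambda>_. 1) (\<lambda>x. \<Sum>i\<in>I. a i * x i)"
  using assms
proof (rule mhom_sum)
  fix i assume "i \<in> I"
  then show "mhom I blk (\<lambda>_. 1) (\<lambda>x. a i * x i)"
    using mhom.coord[of i I blk] by (intro mhom_cmult) simp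
qed

lemma coords_linear_expand:
  assumes fin: "finite I" and L: "coords_linear L I K" and x: "x \<in> vecs I"
  shows "L x k = (\<Sum>i\<in>I. x i * L (unit_vec i) k)"
proof -
  have u: "unit_vec i \<in> vecs I" if "i \<in> I" for i using that by (auto simp: unit_vec_def vecs_def)
  have "(\<lambda>j. if j \<in> A then x j else 0) \<in> vecs I \<and>
      L (\<lambda>j. if j \<in> A then x j else 0) = (\<lambda>k. \<Sum>i\<in>A. x i * L (unit_vec i) k)"
    if "finite A" "A \<subseteq> I" for A
    using that
  proof (induction rule: finite_induct)
    case empty
    show ?case using coords_linear_zero[OF L] by (simp add: vecs_def)
  next
    case (insert a A)
    let ?y = "\<lambda>j. if j \<in> A then x j else 0" and ?z = "\<lambda>j. x a * unit_vec a j"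
    have a: "a \<in> I" using insert by auto
    have z: "?z \<in> vecs I" using u[OF a] by (simp add: vecs_def)
    have "L ?z = (\<lambda>k. x a * L (unit_vec a) k)" using coords_linear_scale[OF L u[OF a]] .
    moreover have "L (\<lambda>j. ?z j + ?y j) = (\<lambda>k. L ?z k + L ?y k)"
      using z insert by (intro coords_linear_add[OF L]) auto
    moreover have "(\<lambda>j. ?z j + ?y j) = (\<lambda>j. if j \<in> insert a A then x j else 0)"
      using insert.hyps by (auto simp: unit_vec_def)
    moreover have "(\<lambda>j. if j \<in> insert a A then x j else 0) \<in> vecs I"
      using x by (simp add: vecs_def)
    ultimately show ?case using insert by simp
  qed
  moreover have "(\<lambda>j. if j \<in> I then x j else 0) = x" using x by (auto simp: vecs_def)
  ultimately show ?thesis using fin by (metis subset_refl)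
qed

lemma coords_linear_inv:
  assumes "coords_linear L I K" "bij_betw L (vecs I) (vecs K)"
  shows "coords_linear (inv_into (vecs I) L) K I"
proof -
  let ?M = "inv_into (vecs I) L"
  have M: "?M y \<in> vecs I" "L (?M y) = y" if "y \<in> vecs K" for y
    using that assms(2) bij_betw_inv_into_right[OF assms(2)]
    by (auto simp: bij_betw_def intro: inv_into_into)
  have eq: "?M y = x" if "x \<in> vecs I" "L x = y" for x y
    using that bij_betw_inv_into_left[OF assms(2)] by blast
  have "?M (\<lambda>k. y k + z k) = (\<lambda>i. ?M y i + ?M z i)" if "y \<in> vecs K" "z \<in> vecs K" for y z
    using M[OF that(1)] M[OF that(2)] coords_linear_add[OF assms(1)]
    by (intro eq) (auto simp: vecs_def)
  moreover have "?M (\<lambda>k. c * y k) = (\<lambda>i. c * ?M y i)" if "y \<in> vecs K" for y c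
    using M[OF that] coords_linear_scale[OF assms(1)]
    by (intro eq) (auto simp: vecs_def)
  ultimately show ?thesis unfolding coords_linear_def using M by blast
qed

lemma mcoords_blk: "mcoords I blk = {x \<in> vecs I. x \<noteq> (\<lambda>_. 0)}" if "I \<noteq> {}"
  using that unfolding mcoords_def vecs_def by fastforce

lemma mpoint_blk_image: "mpoint blk x = (\<lambda>c j. c * x j) ` {c. c \<noteq> 0}"
  unfolding mpoint_blk by blast

lemma coords_linear_point:
  assumes "coords_linear L I K" "x \<in> vecs I"
  shows "L ` mpoint blk x = mpoint blk (L x)"
proof -
  have s: "L (\<lambda>i. c * x i) = (\<lambda>k. c * L x k)" for c
    using assms by (rule coords_linear_scale)
  show ?thesis unfolding mpoint_blk_image image_image s ..
qed

text \<open>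
  An invertible linear map induces an isomorphism of projective spaces. The chart criterion applies
  with a single chart.
\<close>

lemma
  assumes fin: "finite I" "finite K" "I \<noteq> {}" "K \<noteq> {}"
    and L: "coords_linear L I K" and bij: "bij_betw L (vecs I) (vecs K)"
  shows linear_closed_embedding: "closed_embedding (proj_space I) (proj_space K) ((`) L)"
    and linear_inv_image:
      "A \<subseteq> mproj_points I blk \<Longrightarrow> (`) (inv_into (vecs I) L) ` (`) L ` A = A"
proof -
  let ?M = "inv_into (vecs I) L"
  note M = coords_linear_inv[OF L bij]
  have left_inv: "?M (L x) = x" if "x \<in> vecs I" for x
    using bij_betw_inv_into_left[OF bij that] .
  have right_inv: "L (?M y) = y" if "y \<in> vecs K" for y
    using bij_betw_inv_into_right[OF bij that] .
  have Lc: "L x \<in> mcoords K blk" if "x \<in> mcoords I blk" for x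
  proof -
    have x: "x \<in> vecs I" "x \<noteq> (\<lambda>_. 0)" using that fin(3) by (simp_all add: mcoords_blk)
    have "L x \<noteq> (\<lambda>_. 0)" using left_inv[OF x(1)] x(2) coords_linear_zero[OF M] by metis
    then show ?thesis using coords_linear_vecs[OF L x(1)] fin(4) by (simp add: mcoords_blk)
  qed
  have Mc: "?M y \<in> mcoords I blk" if "y \<in> mcoords K blk" for y
  proof -
    have y: "y \<in> vecs K" "y \<noteq> (\<lambda>_. 0)" using that fin(4) by (simp_all add: mcoords_blk)
    have "?M y \<noteq> (\<lambda>_. 0)" using right_inv[OF y(1)] y(2) coords_linear_zero[OF L] by metis
    then show ?thesis using coords_linear_vecs[OF M y(1)] fin(3) by (simp add: mcoords_blk)
  qed
  have Lv: "x \<in> vecs I" if "x \<in> mcoords I blk" for x using that unfolding mcoords_def by blast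
  have Kv: "y \<in> vecs K" if "y \<in> mcoords K blk" for y using that unfolding mcoords_def by blast
  have roundtrip: "?M ` L ` P = P" if "P \<in> mproj_points I blk" for P
  proof -
    have "P \<subseteq> vecs I" using mproj_points_mem(1)[OF that] Lv by blast
    then have "(\<lambda>x. ?M (L x)) ` P = (\<lambda>x. x) ` P" using left_inv by (intro image_cong) auto
    then show ?thesis by (simp add: image_image)
  qed
  show "(`) ?M ` (`) L ` A = A" if "A \<subseteq> mproj_points I blk"
  proof -
    have "(\<lambda>P. ?M ` L ` P) ` A = (\<lambda>P. P) ` A"
      using roundtrip that by (intro image_cong) auto
    then show ?thesis unfolding image_image[of "(`) ?M" "(`) L" A] by simp
  qed
  have surj: "(`) L ` mproj_points I blk = mproj_points K blk"
  proof (intro equalityI subsetI)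
    fix Q assume "Q \<in> (`) L ` mproj_points I blk"
    then obtain x where x: "x \<in> mcoords I blk" "Q = L ` mpoint blk x"
      unfolding mproj_points_eq by blast
    then show "Q \<in> mproj_points K blk"
      using coords_linear_point[OF L Lv] mpoint_in_mproj_points[OF Lc] by simp
  next
    fix Q assume "Q \<in> mproj_points K blk"
    then obtain y where y: "y \<in> mcoords K blk" "Q = mpoint blk y"
      unfolding mproj_points_eq by blast
    have "Q = L ` mpoint blk (?M y)"
      using coords_linear_point[OF L Lv[OF Mc[OF y(1)]]] right_inv[OF Kv[OF y(1)]] y(2) by simp
    then show "Q \<in> (`) L ` mproj_points I blk" using mpoint_in_mproj_points[OF Mc[OF y(1)]] by blast
  qed
  \<comment> \<open>The matrix forms of \<open>L\<close> and its inverse, which are polynomial on all vectors.\<close>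
  let ?L = "\<lambda>x k. \<Sum>i\<in>I. L (unit_vec i) k * x i"
    and ?M' = "\<lambda>y i. \<Sum>k\<in>K. ?M (unit_vec k) i * y k"
  have L': "?L x = L x" if "x \<in> vecs I" for x
    using coords_linear_expand[OF fin(1) L that] by (auto simp: mult.commute)
  have M': "?M' y = ?M y" if "y \<in> vecs K" for y
    using coords_linear_expand[OF fin(2) M that] by (auto simp: mult.commute)
  have im: "?L ` P = L ` P" if "P \<in> mproj_points I blk" for P
    using L' Lv mproj_points_mem(1)[OF that] by (intro image_cong) auto
  interpret chartwise_inverse I blk K blk ?L "\<lambda>_ _. 1" "{()}" "\<lambda>_ _. 1" "\<lambda>_. ?M'" "\<lambda>_ _ _. 1"
  proof
    show "\<exists>d. mhom K blk d (\<lambda>_. 1)" by (blast intro: mhom.const)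
    show "closedin (zariski K blk) ((`) ?L ` mproj_points I blk)"
    proof -
      have "(`) ?L ` mproj_points I blk = mproj_points K blk"
        unfolding surj[symmetric] using im by (rule image_cong[OF refl])
      then show ?thesis by (metis closedin_topspace topspace_zariski)
    qed
    show "?M' (?L x) \<in> mpoint blk x" if "x \<in> mcoords I blk" for x
      using L'[OF Lv[OF that]] M'[OF Kv[OF Lc[OF that]]] left_inv[OF Lv[OF that]] mpoint_self by metis
    show "?L ` mpoint blk x = mpoint blk (?L x)" if "x \<in> mcoords I blk" for x
      using L'[OF Lv[OF that]] im[OF mpoint_in_mproj_points[OF that]]
        coords_linear_point[OF L Lv[OF that]] by simp
    show "?L x \<in> mcoords K blk" if "x \<in> mcoords I blk" for x
      using L'[OF Lv[OF that]] Lc[OF that] by simp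
    show "mhom I blk (\<lambda>_. 1) (\<lambda>x. ?L x k)" for k
      using fin by (intro mhom_linear_form)
    show "mhom K blk (\<lambda>_. 1) (\<lambda>y. ?M' y i)" for i
      using fin by (intro mhom_linear_form)
  qed auto
  show "closed_embedding (proj_space I) (proj_space K) ((`) L)"
    by (rule closed_embedding_cong[OF closed_embedding_image]) (simp add: im topspace_zariski)
qed

section \<open>The Segre embedding\<close>

text \<open>Positions counted from \<open>0\<close>, as in the list operations.\<close>

lemma lc_coords_iff:
  "I \<in> lc_coords n \<longleftrightarrow> length I = n - 3 \<and> (\<forall>k<n-3. I ! k \<in> {1..k+2})"
proof -
  have "(\<forall>m\<in>{1..n-3}. I ! (m-1) \<in> {1..m+1}) \<longleftrightarrow> (\<forall>k<n-3. I ! k \<in> {1..k+2})"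
  proof (intro iffI allI ballI impI)
    fix k assume "\<forall>m\<in>{1..n-3}. I ! (m-1) \<in> {1..m+1}" "k < n - 3"
    then show "I ! k \<in> {1..k+2}" by (elim ballE[of _ _ "Suc k"]) auto
  next
    fix m assume "\<forall>k<n-3. I ! k \<in> {1..k+2}" "m \<in> {1..n-3}"
    then show "I ! (m-1) \<in> {1..m+1}" by (elim allE[of _ "m-1"]) auto
  qed
  then show ?thesis unfolding lc_coords_def by auto
qed

lemma kap_coords_iff: "(m, i) \<in> kap_coords n \<longleftrightarrow> m \<in> {1..n-3} \<and> i \<in> {1..m+1}"
  unfolding kap_coords_def by simp

lemma lc_coords_update:
  "I \<in> lc_coords n \<Longrightarrow> i \<in> {1..k+2} \<Longrightarrow> I[k := i] \<in> lc_coords n"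
  unfolding lc_coords_iff
  by (metis length_list_update nth_list_update_eq nth_list_update_neq)

lemma finite_lc_coords: "finite (lc_coords n)"
proof -
  have "lc_coords n \<subseteq> {I. set I \<subseteq> {1..n} \<and> length I = n - 3}"
  proof
    fix I assume I: "I \<in> lc_coords n"
    have len: "length I = n - 3" using I by (simp add: lc_coords_iff)
    have "x \<in> {1..n}" if x: "x \<in> set I" for x
    proof -
      obtain k where k: "k < n - 3" "x = I ! k" 
        using x len by (auto simp: in_set_conv_nth)
      then have "x \<in> {1..k+2}" using I unfolding lc_coords_iff by blast
      then show ?thesis using k(1) by auto
    qed
    then show "I \<in> {I. set I \<subseteq> {1..n} \<and> length I = n - 3}" using len by auto
  qed
  then show ?thesis using finite_lists_length_eq[of "{1..n}" "n - 3"] finite_subset by blast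
qed

lemma lc_coords_nonempty: "lc_coords n \<noteq> {}"
proof -
  have "replicate (n - 3) 1 \<in> lc_coords n" unfolding lc_coords_iff by simp
  then show ?thesis by blast
qed

lemma segre_vec_shift:
  "I \<in> lc_coords n \<Longrightarrow> segre_vec n x I = (\<Prod>k<n-3. x (Suc k, I ! k))"
  unfolding segre_vec_def
  by (simp, rule prod.reindex_bij_witness[of _ Suc "\<lambda>m. m - 1"]) auto

lemma segre_vec_rescale:
  "segre_vec n (\<lambda>j. c (fst j) * x j) = (\<lambda>I. (\<Prod>k<n-3. c (Suc k)) * segre_vec n x I)"
proof
  fix I show "segre_vec n (\<lambda>j. c (fst j) * x j) I = (\<Prod>k<n-3. c (Suc k)) * segre_vec n x I"
    by (cases "I \<in> lc_coords n") (simp_all add: segre_vec_shift prod.distrib, simp add: segre_vec_def)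
qed

lemma segre_vec_vecs: "segre_vec n x \<in> vecs (lc_coords n)"
  unfolding vecs_def segre_vec_def by simp

lemma segre_point:
  assumes "n \<ge> 4"
  shows "segre_vec n ` mpoint fst x = mpoint blk (segre_vec n x)"
proof (intro equalityI subsetI)
  fix t assume "t \<in> segre_vec n ` mpoint fst x"
  then obtain c where c: "\<And>k. c k \<noteq> 0" "t = segre_vec n (\<lambda>j. c (fst j) * x j)"
    unfolding mpoint_def by blast
  then show "t \<in> mpoint blk (segre_vec n x)" unfolding segre_vec_rescale mpoint_blk
    by (auto intro!: exI[of _ "\<Prod>k<n-3. c (Suc k)"])
next
  fix t assume "t \<in> mpoint blk (segre_vec n x)"
  then obtain a where a: "a \<noteq> 0" "t = (\<lambda>I. a * segre_vec n x I)" unfolding mpoint_blk by blast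
  \<comment> \<open>There is a first factor, as \<open>n \<ge> 4\<close>, and it can absorb the scalar.\<close>
  let ?c = "\<lambda>k::nat. if k = 1 then a else 1"
  have "(\<Prod>k<n-3. ?c (Suc k)) = a"
    using assms prod.delta[of "{..<n-3}" 0 "\<lambda>_. a"] by simp
  then have "t = segre_vec n (\<lambda>j. ?c (fst j) * x j)"
    unfolding segre_vec_rescale[of n ?c] a(2) by (simp only:)
  moreover have "(\<lambda>j. ?c (fst j) * x j) \<in> mpoint fst x"
    unfolding mpoint_def using a(1) by (intro CollectI exI[of _ ?c]) simp
  ultimately show "t \<in> segre_vec n ` mpoint fst x" by blast
qed

lemma segre_vec_update:
  assumes "I \<in> lc_coords n" "i \<in> {1..k+2}" "k < n - 3"
  shows "segre_vec n x (I[k := i]) = x (Suc k, i) * (\<Prod>l\<in>{..<n-3}-{k}. x (Suc l, I ! l))"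
proof -
  have len: "length I = n - 3" using assms(1) by (simp add: lc_coords_iff)
  have "segre_vec n x (I[k := i]) = (\<Prod>l<n-3. x (Suc l, I[k := i] ! l))"
    using lc_coords_update[OF assms(1,2)] by (rule segre_vec_shift)
  also have "\<dots> = x (Suc k, I[k := i] ! k) * (\<Prod>l\<in>{..<n-3}-{k}. x (Suc l, I[k := i] ! l))"
    using assms(3) by (intro prod.remove) auto
  also have "(\<Prod>l\<in>{..<n-3}-{k}. x (Suc l, I[k := i] ! l)) = (\<Prod>l\<in>{..<n-3}-{k}. x (Suc l, I ! l))"
    by (rule prod.cong) auto
  finally show ?thesis using assms(3) len by simp
qed

lemma segre_vec_coord:
  assumes "I \<in> lc_coords n" "k < n - 3"
  shows "segre_vec n x I = x (Suc k, I ! k) * (\<Prod>l\<in>{..<n-3}-{k}. x (Suc l, I ! l))"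
  using segre_vec_update[OF assms(1) _ assms(2), of "I ! k" x] assms
  by (simp add: lc_coords_iff)

lemma kap_mcoords:
  assumes "x \<in> mcoords (kap_coords n) fst" "k < n - 3"
  shows "\<exists>i\<in>{1..k+2}. x (Suc k, i) \<noteq> 0"
proof -
  have "(Suc k, 1) \<in> kap_coords n" using assms(2) by (simp add: kap_coords_iff)
  then have "Suc k \<in> fst ` kap_coords n" by force
  then obtain j where j: "j \<in> kap_coords n" "fst j = Suc k" "x j \<noteq> 0"
    using assms(1) unfolding mcoords_def by blast
  then show ?thesis by (cases j) (auto simp: kap_coords_iff intro!: bexI[of _ "snd j"])
qed

lemma segre_vec_mcoords:
  assumes "x \<in> mcoords (kap_coords n) fst"
  shows "segre_vec n x \<in> mcoords (lc_coords n) blk"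
proof -
  obtain f where f: "\<And>k. k < n - 3 \<Longrightarrow> f k \<in> {1..k+2} \<and> x (Suc k, f k) \<noteq> 0"
    using kap_mcoords[OF assms] by metis
  let ?I = "map f [0..<n-3]"
  have I: "?I \<in> lc_coords n" using f by (simp add: lc_coords_iff)
  then have "segre_vec n x ?I \<noteq> 0" using f by (simp add: segre_vec_shift)
  then have "segre_vec n x \<noteq> (\<lambda>_. 0)" by metis
  then show ?thesis using segre_vec_vecs by (simp add: mcoords_blk lc_coords_nonempty)
qed

text \<open>The quadrics which cut out the Segre variety: exchange one entry of two indices.\<close>

definition segre_quadrics :: "nat \<Rightarrow> ((nat list \<Rightarrow> complex) \<Rightarrow> complex) set" where
  "segre_quadrics n = {\<lambda>t. t I * t I' - t (I[k := I' ! k]) * t (I'[k := I ! k]) | I I' k.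
     I \<in> lc_coords n \<and> I' \<in> lc_coords n \<and> k < n - 3}"

lemma segre_quadrics_hom: "segre_quadrics n \<subseteq> {F. \<exists>d. mhom (lc_coords n) blk d F}"
proof
  fix F assume "F \<in> segre_quadrics n"
  then obtain I I' k where I: "I \<in> lc_coords n" "I' \<in> lc_coords n" "k < n - 3"
    and F: "F = (\<lambda>t. t I * t I' - t (I[k := I' ! k]) * t (I'[k := I ! k]))"
    unfolding segre_quadrics_def by blast
  have c: "mhom (lc_coords n) blk (\<lambda>_. 1) (\<lambda>t. t K)" if "K \<in> lc_coords n" for K
    using mhom.coord[of K "lc_coords n" blk] that by simp
  have "I[k := I' ! k] \<in> lc_coords n" "I'[k := I ! k] \<in> lc_coords n"
    using I by (auto intro!: lc_coords_update simp: lc_coords_iff[of I] lc_coords_iff[of I'])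
  then have "mhom (lc_coords n) blk (\<lambda>_. 1 + 1) F"
    unfolding F using I c by (intro mhom_diff mhom.mult) auto
  then show "F \<in> {F. \<exists>d. mhom (lc_coords n) blk d F}" by blast
qed

text \<open>
  Conversely, a vector \<open>t\<close> satisfying the quadrics and with \<open>t K \<noteq> 0\<close> is proportional to the Segre
  vector of \<open>x (m, i) = t (K[m - 1 := i])\<close>: the entries of \<open>K\<close> are exchanged one after the other for
  those of a given index \<open>I\<close>, each exchange contributing one factor \<open>x (m, I ! (m - 1))\<close>.
\<close>

lemma segre_image:
  assumes n: "n \<ge> 4"
  shows "(`) (segre_vec n) ` mproj_points (kap_coords n) fst =
    zero_locus (lc_coords n) blk (segre_quadrics n)" (is "?L = ?R")
proof (intro equalityI subsetI)
  fix Q assume "Q \<in> ?L"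
  then obtain P where P: "P \<in> mproj_points (kap_coords n) fst" "Q = segre_vec n ` P" by blast
  obtain x where x: "x \<in> P" "x \<in> mcoords (kap_coords n) fst" "P = mpoint fst x"
    using P(1) by (rule mproj_pointsE)
  have "F (segre_vec n y) = 0" if F: "F \<in> segre_quadrics n" for F y
  proof -
    obtain I I' k where I: "I \<in> lc_coords n" "I' \<in> lc_coords n" "k < n - 3"
      and F: "F = (\<lambda>t. t I * t I' - t (I[k := I' ! k]) * t (I'[k := I ! k]))"
      using F unfolding segre_quadrics_def by blast
    have r: "I ! k \<in> {1..k+2}" "I' ! k \<in> {1..k+2}" using I by (auto simp: lc_coords_iff)
    show ?thesis unfolding F segre_vec_update[OF I(1) r(2) I(3)] segre_vec_update[OF I(2) r(1) I(3)]
        segre_vec_coord[OF I(1,3)] segre_vec_coord[OF I(2,3)] by simp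
  qed
  moreover have "Q \<in> mproj_points (lc_coords n) blk"
    unfolding P(2) x(3) segre_point[OF n] using segre_vec_mcoords[OF x(2)]
    by (rule mpoint_in_mproj_points)
  ultimately show "Q \<in> ?R" unfolding zero_locus_def P(2) by blast
next
  fix Q assume Q: "Q \<in> ?R"
  then have "Q \<in> mproj_points (lc_coords n) blk" unfolding zero_locus_def by blast
  then obtain t where t: "t \<in> Q" "t \<in> mcoords (lc_coords n) blk" "Q = mpoint blk t"
    by (rule mproj_pointsE)
  have quad: "t I * t I' = t (I[k := I' ! k]) * t (I'[k := I ! k])"
    if "I \<in> lc_coords n" "I' \<in> lc_coords n" "k < n - 3" for I I' k
  proof -
    have "(\<lambda>t. t I * t I' - t (I[k := I' ! k]) * t (I'[k := I ! k])) \<in> segre_quadrics n"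
      using that unfolding segre_quadrics_def by blast
    then have "t I * t I' - t (I[k := I' ! k]) * t (I'[k := I ! k]) = 0"
      using Q t(1) unfolding zero_locus_def by fast
    then show ?thesis by simp
  qed
  have tv: "t \<in> vecs (lc_coords n)" "t \<noteq> (\<lambda>_. 0)"
    using t(2) lc_coords_nonempty by (simp_all add: mcoords_blk)
  then obtain K where K: "K \<in> lc_coords n" "t K \<noteq> 0" unfolding vecs_def by blast
  have lenO: "length K = n - 3" using K(1) by (simp add: lc_coords_iff)
  let ?x = "\<lambda>(m, i). if (m, i) \<in> kap_coords n then t (K[m - 1 := i]) else 0"
  have "t (take k I @ drop k K) * t K ^ k = t K * (\<Prod>l<k. t (K[l := I ! l]))"
    if I: "I \<in> lc_coords n" and k: "k \<le> n - 3" for I k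
    using k
  proof (induction k)
    case 0
    then show ?case by simp
  next
    case (Suc k)
    let ?A = "take k I @ drop k K" and ?B = "K[k := I ! k]"
    have len: "length I = n - 3" using I by (simp add: lc_coords_iff)
    have A: "?A \<in> lc_coords n" using I K(1) Suc.prems
      by (auto simp: lc_coords_iff nth_append min_def)
    have B: "?B \<in> lc_coords n" using I K(1) Suc.prems
      by (intro lc_coords_update) (auto simp: lc_coords_iff)
    have "?A[k := ?B ! k] = take (Suc k) I @ drop (Suc k) K"
      using len lenO Suc.prems
      by (intro nth_equalityI) (auto simp: nth_append nth_list_update min_def less_Suc_eq)
    moreover have "?B[k := ?A ! k] = K"
      using len lenO Suc.prems by (simp add: nth_append)
    ultimately have "t (take (Suc k) I @ drop (Suc k) K) * t K = t ?A * t ?B"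
      using quad[OF A B, of k] Suc.prems by (simp only: Suc_le_eq)
    then have "t (take (Suc k) I @ drop (Suc k) K) * t K ^ Suc k = t ?A * t K ^ k * t ?B"
      by (simp add: algebra_simps)
    then show ?case using Suc by simp
  qed
  from this[OF _ order_refl] have "t I * t K ^ (n - 3) = t K * segre_vec n ?x I"
    if "I \<in> lc_coords n" for I
    using that lenO by (simp add: segre_vec_shift) (simp add: lc_coords_iff kap_coords_iff)
  then have "segre_vec n ?x I = t K ^ (n - 3) / t K * t I" if "I \<in> lc_coords n" for I
    using that K(2) by (simp add: field_simps)
  moreover have "segre_vec n ?x I = t K ^ (n - 3) / t K * t I" if "I \<notin> lc_coords n" for I
    using that tv(1) by (simp add: segre_vec_def vecs_def)
  ultimately have "segre_vec n ?x = (\<lambda>I. t K ^ (n - 3) / t K * t I)" by blast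
  then have "segre_vec n ?x \<in> mpoint blk t"
    unfolding mpoint_blk using K(2) by (intro CollectI exI[of _ "t K ^ (n - 3) / t K"]) simp
  from mpoint_eq[OF this] have Qx: "Q = segre_vec n ` mpoint fst ?x"
    unfolding t(3) segre_point[OF n] by (rule sym)
  have "?x \<in> mcoords (kap_coords n) fst"
    unfolding mcoords_def
  proof (intro CollectI conjI ballI)
    show "?x \<in> vecs (kap_coords n)" unfolding vecs_def by auto
    fix m assume "m \<in> fst ` kap_coords n"
    then have m: "m \<in> {1..n-3}" unfolding kap_coords_def by auto
    then have "m - 1 < n - 3" by auto
    then have "K ! (m - 1) \<in> {1..(m-1)+2}" using K(1) unfolding lc_coords_iff by blast
    then have "(m, K ! (m - 1)) \<in> kap_coords n" using m by (auto simp: kap_coords_iff)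
    then show "\<exists>j\<in>kap_coords n. fst j = m \<and> ?x j \<noteq> 0"
      using K(2) by (intro bexI[of _ "(m, K ! (m - 1))"]) auto
  qed
  then show "Q \<in> ?L" unfolding Qx using mpoint_in_mproj_points by blast
qed

text \<open>
  On the chart \<open>t K \<noteq> 0\<close>, the Segre embedding is inverted by linear forms: fixing all entries of the
  index except the \<open>m\<close>-th to those of \<open>K\<close> recovers the \<open>m\<close>-th factor up to scaling.
\<close>

lemma segre_closed_embedding:
  assumes n: "n \<ge> 4"
  shows "closed_embedding (kap_space n) (proj_space (lc_coords n)) (segre n)"
proof -
  let ?\<Psi> = "\<lambda>K t (m, i). if (m, i) \<in> kap_coords n then t (K[m - 1 := i]) else (0::complex)"
  interpret chartwise_inverse "kap_coords n" fst "lc_coords n" blk "segre_vec n"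
    "\<lambda>_ k. if k \<in> {1..n-3} then 1 else 0" "lc_coords n" "\<lambda>K t. t K" ?\<Psi> "\<lambda>_ _ _. 1"
  proof
    fix I assume I: "I \<in> lc_coords n"
    have "mhom (kap_coords n) fst (\<lambda>k. \<Sum>m\<in>{1..n-3}. if k = m then 1 else 0)
        (\<lambda>x. \<Prod>m\<in>{1..n-3}. x (m, I ! (m - 1)))"
    proof (rule mhom_prod)
      fix m assume "m \<in> {1..n-3}"
      then have "(m, I ! (m - 1)) \<in> kap_coords n"
        using I by (auto simp: lc_coords_def kap_coords_iff)
      then show "mhom (kap_coords n) fst (\<lambda>k. if k = m then 1 else 0) (\<lambda>x. x (m, I ! (m - 1)))"
        using mhom.coord[of "(m, I ! (m - 1))" "kap_coords n" fst] by simp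
    qed simp
    then show "mhom (kap_coords n) fst (\<lambda>k. if k \<in> {1..n-3} then 1 else 0)
        (\<lambda>x. segre_vec n x I)"
      using I by (simp add: segre_vec_def)
    show "\<exists>d. mhom (lc_coords n) blk d (\<lambda>t. t I)" using mhom.coord[OF I] by blast
  next
    fix x assume "x \<in> mcoords (kap_coords n) fst"
    then show "segre_vec n x \<in> mcoords (lc_coords n) blk" by (rule segre_vec_mcoords)
    then show "\<exists>K\<in>lc_coords n. segre_vec n x K \<noteq> 0"
      using lc_coords_nonempty[of n] unfolding mcoords_def by blast
  next
    fix K j assume K: "K \<in> lc_coords n" and j: "j \<in> kap_coords n"
    obtain m i where mi: "j = (m, i)" by fastforce
    have "K[m - 1 := i] \<in> lc_coords n"
      using K j unfolding mi by (intro lc_coords_update) (auto simp: kap_coords_iff)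
    then show "mhom (lc_coords n) blk (\<lambda>_. 1) (\<lambda>t. ?\<Psi> K t j)"
      using mhom.coord[of "K[m - 1 := i]" "lc_coords n" blk] j by (simp add: mi)
  next
    fix K x assume K: "K \<in> lc_coords n" and x: "x \<in> mcoords (kap_coords n) fst"
      and nz: "segre_vec n x K \<noteq> 0"
    let ?c = "\<lambda>m. if m \<in> {1..n-3} then segre_vec n x K / x (m, K ! (m - 1)) else 1"
    have nzm: "x (m, K ! (m - 1)) \<noteq> 0" if "m \<in> {1..n-3}" for m
    proof -
      have "m - 1 < n - 3" using that by auto
      then have "x (Suc (m - 1), K ! (m - 1)) \<noteq> 0"
        using segre_vec_coord[OF K, of "m - 1" x] nz that by force
      then show ?thesis using that by simp
    qed
    have "?\<Psi> K (segre_vec n x) (m, i) = ?c m * x (m, i)" for m i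
    proof (cases "(m, i) \<in> kap_coords n")
      case True
      then have mi: "m \<in> {1..n-3}" "i \<in> {1..(m-1)+2}" "m - 1 < n - 3"
        by (auto simp: kap_coords_iff)
      then show ?thesis
        using True segre_vec_update[OF K mi(2,3), of x] segre_vec_coord[OF K mi(3), of x] nzm[OF mi(1)]
        by simp
    next
      case False
      then show ?thesis using x by (auto simp: mcoords_def vecs_def)
    qed
    then show "?\<Psi> K (segre_vec n x) \<in> mpoint fst x"
      unfolding mpoint_def using nz nzm by (intro CollectI exI[of _ ?c]) auto
  next
    show "closedin (zariski (lc_coords n) blk)
        ((`) (segre_vec n) ` mproj_points (kap_coords n) fst)"
      unfolding segre_image[OF n] closedin_zariski using segre_quadrics_hom by blast
  qed (rule segre_point[OF n])
  show ?thesis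
    by (rule closed_embedding_cong[OF closed_embedding_image]) (simp add: segre_def)
qed

section \<open>Insertion of the largest letter\<close>

text \<open>The word obtained from \<open>\<sigma>\<close> by inserting the letter \<open>c\<close> behind the first \<open>k\<close> letters.\<close>

definition insert_at :: "nat \<Rightarrow> nat list \<Rightarrow> nat \<Rightarrow> nat list" where
  "insert_at c \<sigma> k = take k \<sigma> @ c # drop k \<sigma>"

lemma Sig_length: "\<sigma> \<in> Sig n \<Longrightarrow> length \<sigma> = n"
  using distinct_card[of \<sigma>] by (auto simp: Sig_def)

lemma finite_Sig: "finite (Sig n)"
proof -
  have "Sig n \<subseteq> {\<sigma>. set \<sigma> \<subseteq> {1..n} \<and> length \<sigma> = n}" using Sig_length by (auto simp: Sig_def)
  then show ?thesis using finite_lists_length_eq[of "{1..n}" n] finite_subset by blast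
qed

lemma insert_at_Sig:
  assumes "\<sigma> \<in> Sig n" "k \<in> {2..n}"
  shows "insert_at (Suc n) \<sigma> k \<in> Sig (Suc n)"
proof -
  have s: "distinct \<sigma>" "set \<sigma> = {1..n}" "\<sigma> ! 0 = 1" "\<sigma> ! 1 = 2" "length \<sigma> = n"
    using assms Sig_length by (auto simp: Sig_def)
  have "set (take k \<sigma>) \<union> set (drop k \<sigma>) = {1..n}"
    using s(2) by (metis append_take_drop_id set_append)
  then have "set (insert_at (Suc n) \<sigma> k) = {1..Suc n}"
    unfolding insert_at_def by auto
  moreover have "distinct (insert_at (Suc n) \<sigma> k)"
    using s(1,2) set_take_subset[of k \<sigma>] set_drop_subset[of k \<sigma>]
      set_take_disj_set_drop_if_distinct[OF s(1), of k k]
    unfolding insert_at_def by auto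
  moreover have "insert_at (Suc n) \<sigma> k ! 0 = 1" "insert_at (Suc n) \<sigma> k ! 1 = 2"
    using s assms(2) unfolding insert_at_def by (simp_all add: nth_append)
  ultimately show ?thesis by (simp add: Sig_def)
qed

lemma remove1_insert_at: "\<sigma> \<in> Sig n \<Longrightarrow> remove1 (Suc n) (insert_at (Suc n) \<sigma> k) = \<sigma>"
proof -
  assume "\<sigma> \<in> Sig n"
  then have "Suc n \<notin> set (take k \<sigma>)" using set_take_subset[of k \<sigma>] by (auto simp: Sig_def)
  then show ?thesis unfolding insert_at_def by (simp add: remove1_append)
qed

lemma insert_at_nth:
  assumes "k \<le> length \<sigma>"
  shows "insert_at c \<sigma> k ! k = c" and "i < k \<Longrightarrow> insert_at c \<sigma> k ! i = \<sigma> ! i"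
  using assms unfolding insert_at_def by (simp_all add: nth_append)

lemma length_insert_at [simp]: "length (insert_at c \<sigma> k) = Suc (length \<sigma>)"
  unfolding insert_at_def by simp

lemma insert_at_inj:
  assumes "\<sigma> \<in> Sig n" "k \<in> {2..n}" "l \<in> {2..n}" "insert_at (Suc n) \<sigma> k = insert_at (Suc n) \<sigma> l"
  shows "k = l"
proof -
  have len: "length \<sigma> = n" using assms(1) by (rule Sig_length)
  have "distinct (insert_at (Suc n) \<sigma> k)"
    using insert_at_Sig[OF assms(1,2)] by (simp add: Sig_def)
  moreover have "insert_at (Suc n) \<sigma> k ! k = Suc n" "insert_at (Suc n) \<sigma> k ! l = Suc n"
    using insert_at_nth(1)[of k \<sigma> "Suc n"] insert_at_nth(1)[of l \<sigma> "Suc n"] assms(2-4) len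
    by (simp_all only: atLeastAtMost_iff)
  ultimately show ?thesis
    using assms(2,3) len nth_eq_iff_index_eq[of "insert_at (Suc n) \<sigma> k" k l] by simp
qed

lemma Sig_Suc_cases:
  assumes "\<tau> \<in> Sig (Suc n)" "n \<ge> 2"
  obtains \<sigma> k where "\<sigma> \<in> Sig n" "k \<in> {2..n}" "\<tau> = insert_at (Suc n) \<sigma> k"
proof -
  have t: "distinct \<tau>" "set \<tau> = {1..Suc n}" "\<tau> ! 0 = 1" "\<tau> ! 1 = 2" "length \<tau> = Suc n"
    using assms Sig_length by (auto simp: Sig_def)
  then have "Suc n \<in> set \<tau>" by simp
  then obtain xs ys where xy: "\<tau> = xs @ Suc n # ys" by (meson split_list)
  have k: "length xs \<ge> 2"
  proof (rule ccontr)
    assume "\<not> length xs \<ge> 2"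
    then have "length xs = 0 \<or> length xs = 1" by linarith
    then show False using t(3,4) assms(2) unfolding xy by (auto simp: nth_append)
  qed
  have "{1..n} = set \<tau> - {Suc n}" unfolding t(2) by auto
  also have "\<dots> = set (xs @ ys)" using t(1) unfolding xy by auto
  finally have "xs @ ys \<in> Sig n"
    using t(1,3,4) k unfolding xy by (auto simp: Sig_def nth_append)
  moreover have "length xs \<in> {2..n}" using k t(5) unfolding xy by auto
  moreover have "\<tau> = insert_at (Suc n) (xs @ ys) (length xs)" unfolding xy insert_at_def by simp
  ultimately show thesis by (rule that)
qed

lemma bij_insert_at:
  assumes "n \<ge> 2"
  shows "bij_betw (\<lambda>(\<sigma>, k). insert_at (Suc n) \<sigma> k) (Sig n \<times> {2..n}) (Sig (Suc n))"
  unfolding bij_betw_def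
proof
  show "inj_on (\<lambda>(\<sigma>, k). insert_at (Suc n) \<sigma> k) (Sig n \<times> {2..n})"
  proof (rule inj_onI, clarify)
    fix \<sigma> k \<sigma>' k'
    assume *: "\<sigma> \<in> Sig n" "\<sigma>' \<in> Sig n" "k \<in> {2..n}" "k' \<in> {2..n}"
      "insert_at (Suc n) \<sigma> k = insert_at (Suc n) \<sigma>' k'"
    have "\<sigma> = \<sigma>'"
      using arg_cong[OF *(5), of "remove1 (Suc n)"]
      unfolding remove1_insert_at[OF *(1)] remove1_insert_at[OF *(2)] .
    moreover have "k = k'"
      using * \<open>\<sigma> = \<sigma>'\<close> by (intro insert_at_inj[of \<sigma> n k k']) simp_all
    ultimately show "\<sigma> = \<sigma>' \<and> k = k'" ..
  qed
  show "(\<lambda>(\<sigma>, k). insert_at (Suc n) \<sigma> k) ` (Sig n \<times> {2..n}) = Sig (Suc n)"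
  proof (intro equalityI subsetI)
    fix \<tau> assume "\<tau> \<in> Sig (Suc n)"
    then obtain \<sigma> k where "\<sigma> \<in> Sig n" "k \<in> {2..n}" "\<tau> = insert_at (Suc n) \<sigma> k"
      using assms by (rule Sig_Suc_cases)
    then show "\<tau> \<in> (\<lambda>(\<sigma>, k). insert_at (Suc n) \<sigma> k) ` (Sig n \<times> {2..n})"
      by (intro image_eqI[of _ _ "(\<sigma>, k)"]) simp_all
  qed (use insert_at_Sig in auto)
qed

text \<open>
  The new letter stands to the right of the letter at position \<open>j\<close> exactly when it is inserted
  behind at least \<open>Suc j\<close> letters.
\<close>

lemma Z_index_eq:
  assumes "\<sigma> \<in> Sig n" "n \<ge> 2" "1 \<le> j" "j < n"
  shows "Z_index (Suc n) (\<sigma> ! j) \<sigma> = insert_at (Suc n) \<sigma> ` {Suc j..n}"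
proof -
  have len: "length \<sigma> = n" and d: "distinct \<sigma>" using assms(1) Sig_length by (auto simp: Sig_def)
  have r: "right_of (insert_at (Suc n) \<sigma> k) (\<sigma> ! j) (Suc n) \<longleftrightarrow> j < k" if k: "k \<in> {2..n}" for k
  proof
    have dd: "distinct (insert_at (Suc n) \<sigma> k)"
      using insert_at_Sig[OF assms(1) k] by (simp add: Sig_def)
    assume "right_of (insert_at (Suc n) \<sigma> k) (\<sigma> ! j) (Suc n)"
    then obtain i l where il: "i < l" "l < Suc n" "insert_at (Suc n) \<sigma> k ! i = \<sigma> ! j"
      "insert_at (Suc n) \<sigma> k ! l = Suc n"
      unfolding right_of_def length_insert_at len by blast
    have "insert_at (Suc n) \<sigma> k ! l = insert_at (Suc n) \<sigma> k ! k"
      using il(4) insert_at_nth(1)[of k \<sigma>] k len by simp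
    then have "l = k" using dd il(2) k len by (simp add: nth_eq_iff_index_eq)
    then have "\<sigma> ! i = \<sigma> ! j" using insert_at_nth(2)[of k \<sigma> i] il k len by simp
    then have "i = j" using d il k \<open>l = k\<close> assms(4) len by (simp add: nth_eq_iff_index_eq)
    then show "j < k" using il \<open>l = k\<close> by simp
  next
    assume "j < k"
    then show "right_of (insert_at (Suc n) \<sigma> k) (\<sigma> ! j) (Suc n)"
      unfolding right_of_def using insert_at_nth[of k \<sigma>] k len
      by (intro exI[of _ j] exI[of _ k]) auto
  qed
  show ?thesis
  proof (intro equalityI subsetI)
    fix \<tau> assume "\<tau> \<in> Z_index (Suc n) (\<sigma> ! j) \<sigma>"
    then have t: "\<tau> \<in> Sig (Suc n)" "remove1 (Suc n) \<tau> = \<sigma>" "right_of \<tau> (\<sigma> ! j) (Suc n)"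
      unfolding Z_index_def by auto
    obtain \<rho> k where \<rho>: "\<rho> \<in> Sig n" "k \<in> {2..n}" "\<tau> = insert_at (Suc n) \<rho> k"
      using Sig_Suc_cases[OF t(1) assms(2)] by blast
    then have "\<rho> = \<sigma>" using t(2) by (simp only: remove1_insert_at)
    then show "\<tau> \<in> insert_at (Suc n) \<sigma> ` {Suc j..n}" using \<rho> t(3) r by auto
  next
    fix \<tau> assume "\<tau> \<in> insert_at (Suc n) \<sigma> ` {Suc j..n}"
    then obtain k where k: "k \<in> {Suc j..n}" "\<tau> = insert_at (Suc n) \<sigma> k" by blast
    then have "k \<in> {2..n}" using assms(3) by auto
    then show "\<tau> \<in> Z_index (Suc n) (\<sigma> ! j) \<sigma>"
      using k insert_at_Sig[OF assms(1)] remove1_insert_at[OF assms(1)] r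
      unfolding Z_index_def by auto
  qed
qed

lemma Zform_eq:
  assumes "\<sigma> \<in> Sig n" "n \<ge> 2" "1 \<le> j" "j < n"
  shows "Zform (Suc n) (\<sigma> ! j) \<sigma> z = (\<Sum>k\<in>{Suc j..n}. z (insert_at (Suc n) \<sigma> k))"
proof -
  have "inj_on (insert_at (Suc n) \<sigma>) {Suc j..n}"
    using insert_at_inj[OF assms(1)] assms(3) by (intro inj_onI) auto
  then show ?thesis unfolding Zform_def Z_index_eq[OF assms] by (simp add: sum.reindex)
qed

lemma Sig_index:
  assumes "\<sigma> \<in> Sig n" "a \<in> {2..n}"
  obtains j where "1 \<le> j" "j < n" "\<sigma> ! j = a"
proof -
  have "a \<in> set \<sigma>" using assms by (auto simp: Sig_def)
  then obtain j where j: "j < n" "\<sigma> ! j = a"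
    using Sig_length[OF assms(1)] by (auto simp: in_set_conv_nth)
  have "\<sigma> ! 0 \<noteq> a" using assms by (auto simp: Sig_def)
  then have "j \<noteq> 0" using j(2) by metis
  then show thesis using j by (intro that[of j]) simp_all
qed

lemma Sig_letter:
  assumes "\<sigma> \<in> Sig n" "1 \<le> j" "j < n"
  shows "\<sigma> ! j \<in> {2..n}"
proof -
  have s: "distinct \<sigma>" "set \<sigma> = {1..n}" "\<sigma> ! 0 = 1" "length \<sigma> = n"
    using assms(1) Sig_length by (auto simp: Sig_def)
  have "\<sigma> ! j \<in> {1..n}" using s assms(3) nth_mem by blast
  moreover have "\<sigma> ! j \<noteq> \<sigma> ! 0" 
    using nth_eq_iff_index_eq[OF s(1), of j 0] s(4) assms(2,3) by linarith
  ultimately show ?thesis using s(3) by auto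
qed

section \<open>The recursive change of coordinates\<close>

text \<open>
  The index sets of the linear forms, for \<open>n = k + 3\<close>. The recursion of the sets \<open>Bset\<close> extends
  downwards to \<open>n = 3\<close>, where there is a single coordinate on either side.
\<close>

primrec form_set :: "nat \<Rightarrow> nat list \<Rightarrow> nat list set" where
  "form_set 0 I = {[1, 2, 3]}"
| "form_set (Suc k) I = (\<Union>\<sigma>\<in>form_set k (butlast I). Z_index (Suc (k + 3)) (last I + 1) \<sigma>)"

text \<open>The linear form with index \<open>I\<close>, a sum of coordinates.\<close>

definition lin_form :: "nat \<Rightarrow> (nat list \<Rightarrow> complex) \<Rightarrow> nat list \<Rightarrow> complex" where
  "lin_form k z I = (\<Sum>\<tau>\<in>form_set k I. z \<tau>)"

text \<open>The linear map with these components, for \<open>n = k + 3\<close>.\<close>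

definition form_map :: "nat \<Rightarrow> (nat list \<Rightarrow> complex) \<Rightarrow> nat list \<Rightarrow> complex" where
  "form_map k z = (\<lambda>I. if I \<in> lc_coords (k + 3) then lin_form k z I else 0)"

lemma Sig_3: "Sig 3 = {[1, 2, 3]}"
proof (intro equalityI subsetI)
  fix \<sigma> assume s: "\<sigma> \<in> Sig 3"
  then have "length \<sigma> = 3" by (rule Sig_length)
  then obtain a b c where abc: "\<sigma> = [a, b, c]" by (auto simp: numeral_eq_Suc length_Suc_conv)
  have "{1..3::nat} = {1, 2, 3}" by auto
  then have "c = 3" using s unfolding abc by (auto simp: Sig_def)
  then show "\<sigma> \<in> {[1, 2, 3]}" using s unfolding abc by (simp add: Sig_def)
next
  fix \<sigma> :: "nat list" assume "\<sigma> \<in> {[1, 2, 3]}"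
  then show "\<sigma> \<in> Sig 3" by (auto simp: Sig_def)
qed

lemma form_set_Sig: "form_set k I \<subseteq> Sig (k + 3)"
proof (cases k)
  case 0
  then show ?thesis using Sig_3 by simp
next
  case (Suc l)
  then show ?thesis by (auto simp: Z_index_def)
qed

lemma finite_form_set: "finite (form_set k I)"
  using form_set_Sig finite_Sig finite_subset by blast

lemma finite_Z_index: "finite (Z_index n a \<sigma>)"
  using finite_Sig finite_subset unfolding Z_index_def by (metis (no_types, lifting) mem_Collect_eq subsetI)

lemma sum_Z_index:
  assumes "finite S"
  shows "(\<Sum>\<tau>\<in>(\<Union>\<sigma>\<in>S. Z_index n a \<sigma>). z \<tau>) = (\<Sum>\<sigma>\<in>S. Zform n a \<sigma> z)"
  unfolding Zform_def using assms finite_Z_index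
  by (intro sum.UNION_disjoint) (auto simp: Z_index_def)

lemma lin_form_snoc:
  "lin_form (Suc k) z (I @ [i]) = lin_form k (\<lambda>\<sigma>. Zform (Suc (k + 3)) (i + 1) \<sigma> z) I"
  unfolding lin_form_def by (simp add: sum_Z_index finite_form_set)

lemma lin_form_cong:
  "(\<And>\<sigma>. \<sigma> \<in> Sig (k + 3) \<Longrightarrow> z \<sigma> = z' \<sigma>) \<Longrightarrow> lin_form k z I = lin_form k z' I"
  unfolding lin_form_def using form_set_Sig by (intro sum.cong) auto

lemma lin_form_scale: "lin_form k (\<lambda>\<sigma>. c * z \<sigma>) I = c * lin_form k z I"
  unfolding lin_form_def by (simp add: sum_distrib_left)

lemma lin_form_add: "lin_form k (\<lambda>\<sigma>. z \<sigma> + y \<sigma>) I = lin_form k z I + lin_form k y I"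
  unfolding lin_form_def by (simp add: sum.distrib)

lemma lc_coords_3: "lc_coords 3 = {[]}"
  unfolding lc_coords_def by auto

lemma lc_coords_snoc:
  "I @ [i] \<in> lc_coords (Suc (k + 3)) \<longleftrightarrow> I \<in> lc_coords (k + 3) \<and> i \<in> {1..k+2}"
proof -
  have "{1..Suc k} = insert (Suc k) {1..k}" by auto
  then have *: "(\<forall>m\<in>{1..Suc k}. P m) \<longleftrightarrow> (\<forall>m\<in>{1..k}. P m) \<and> P (Suc k)" for P
    by (metis insert_iff)
  show ?thesis
  proof (cases "length I = k")
    case True
    then have "(\<forall>m\<in>{1..k}. (I @ [i]) ! (m-1) \<in> {1..m+1}) \<longleftrightarrow> (\<forall>m\<in>{1..k}. I ! (m-1) \<in> {1..m+1})"
      by (intro ball_cong) (auto simp: nth_append)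
    moreover have "(I @ [i]) ! k = i" using True by auto
    ultimately show ?thesis using True * unfolding lc_coords_def by simp
  qed (simp add: lc_coords_def)
qed

lemma lc_coords_Suc_cases:
  assumes "I \<in> lc_coords (Suc (k + 3))"
  obtains I' i where "I = I' @ [i]" "I' \<in> lc_coords (k + 3)" "i \<in> {1..k+2}"
proof -
  have "I \<noteq> []" using assms by (auto simp: lc_coords_def)
  then have "I = butlast I @ [last I]" by simp
  then show thesis using assms lc_coords_snoc that by metis
qed

text \<open>
  The induction hypothesis, applied for each letter \<open>a\<close> to the values \<open>Zform a \<sigma> z\<close>, shows that these
  vanish. For consecutive letters of \<open>\<sigma>\<close> they differ by one coordinate of \<open>z\<close>.
\<close>

lemma lin_form_kernel:
  assumes "\<And>I. I \<in> lc_coords (k + 3) \<Longrightarrow> lin_form k z I = 0" "\<sigma> \<in> Sig (k + 3)"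
  shows "z \<sigma> = 0"
  using assms
proof (induction k arbitrary: z \<sigma>)
  case 0
  then show ?case using lc_coords_3 Sig_3 by (simp add: lin_form_def)
next
  case (Suc k)
  let ?n = "k + 3"
  have Z: "Zform (Suc ?n) a \<rho> z = 0" if "\<rho> \<in> Sig ?n" "a \<in> {2..?n}" for a \<rho>
  proof (rule Suc.IH[OF _ that(1)])
    fix I assume "I \<in> lc_coords ?n"
    then have "I @ [a - 1] \<in> lc_coords (Suc ?n)"
      using that(2) unfolding lc_coords_snoc by auto
    then have "lin_form (Suc k) z (I @ [a - 1]) = 0" using Suc.prems(1) by simp
    then show "lin_form k (\<lambda>\<sigma>. Zform (Suc ?n) a \<sigma> z) I = 0"
      unfolding lin_form_snoc using that(2) by simp
  qed
  have "\<sigma> \<in> Sig (Suc ?n)" using Suc.prems(2) by simp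
  then obtain \<rho> m where \<rho>: "\<rho> \<in> Sig ?n" "m \<in> {2..?n}" "\<sigma> = insert_at (Suc ?n) \<rho> m"
    by (rule Sig_Suc_cases) auto
  let ?s = "\<lambda>l. \<Sum>k\<in>{l..?n}. z (insert_at (Suc ?n) \<rho> k)"
  have s: "?s (Suc j) = 0" if "1 \<le> j" for j
  proof (cases "j < ?n")
    case True
    then show ?thesis
      using Zform_eq[OF \<rho>(1) _ that True, of z] Z[OF \<rho>(1) Sig_letter[OF \<rho>(1) that True]] by simp
  qed simp
  have "?s m = z \<sigma> + ?s (Suc m)" using \<rho>(2,3) by (simp add: sum.atLeast_Suc_atMost)
  moreover have "1 \<le> m - 1" "Suc (m - 1) = m" using \<rho>(2) by auto
  with s[of "m - 1"] have "?s m = 0" by metis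
  ultimately show ?case using s[of m] \<rho>(2) by simp
qed

lemma lin_form_surj: "\<exists>z\<in>vecs (Sig (k + 3)). \<forall>I\<in>lc_coords (k + 3). lin_form k z I = y I"
proof (induction k arbitrary: y)
  case 0
  then show ?case
    by (intro bexI[of _ "\<lambda>\<sigma>. if \<sigma> = [1,2,3] then y [] else 0"])
      (auto simp: lc_coords_3 Sig_3 lin_form_def vecs_def)
next
  case (Suc k)
  let ?n = "k + 3"
  have "\<forall>a. \<exists>w. \<forall>I\<in>lc_coords ?n. lin_form k w I = y (I @ [a - 1])"
  proof
    fix a
    show "\<exists>w. \<forall>I\<in>lc_coords ?n. lin_form k w I = y (I @ [a - 1])"
      using Suc.IH[of "\<lambda>I. y (I @ [a - 1])"] by blast
  qed
  then obtain w where w: "\<And>a I. I \<in> lc_coords ?n \<Longrightarrow> lin_form k (w a) I = y (I @ [a - 1])"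
    by metis
  \<comment> \<open>\<open>Zform\<close> sums over a final segment of the insertion positions. With coordinates that are
    differences of consecutive values of \<open>W\<close>, this sum telescopes to the prescribed value.\<close>
  define W where "W = (\<lambda>\<sigma> m. if m \<le> ?n then w (\<sigma> ! (m - 1)) \<sigma> else 0)"
  let ?ins = "\<lambda>(\<sigma>, m). insert_at (Suc ?n) \<sigma> m" and ?D = "Sig ?n \<times> {2..?n}"
  define z where "z = (\<lambda>\<tau>. if \<tau> \<in> Sig (Suc ?n)
    then (case inv_into ?D ?ins \<tau> of (\<sigma>, m) \<Rightarrow> W \<sigma> m - W \<sigma> (Suc m)) else 0)"
  have bij: "bij_betw ?ins ?D (Sig (Suc ?n))" by (rule bij_insert_at) simp
  have z_ins: "z (insert_at (Suc ?n) \<sigma> m) = W \<sigma> m - W \<sigma> (Suc m)"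
    if "\<sigma> \<in> Sig ?n" "m \<in> {2..?n}" for \<sigma> m
    using bij_betw_inv_into_left[OF bij, of "(\<sigma>, m)"] insert_at_Sig[OF that] that
    unfolding z_def by simp
  have Z: "Zform (Suc ?n) a \<sigma> z = w a \<sigma>" if s: "\<sigma> \<in> Sig ?n" and a: "a \<in> {2..?n}" for a \<sigma>
  proof -
    obtain j where j: "1 \<le> j" "j < ?n" "\<sigma> ! j = a" using s a by (rule Sig_index)
    have "Zform (Suc ?n) a \<sigma> z = (\<Sum>m\<in>{Suc j..?n}. z (insert_at (Suc ?n) \<sigma> m))"
      using Zform_eq[OF s _ j(1,2)] j(3) by simp
    also have "\<dots> = (\<Sum>m\<in>{Suc j..?n}. W \<sigma> m - W \<sigma> (Suc m))"
      using z_ins[OF s] j(1) by (intro sum.cong) auto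
    also have "\<dots> = W \<sigma> (Suc j) - W \<sigma> (Suc ?n)"
      using sum_Suc_diff[of "Suc j" ?n "\<lambda>m. - W \<sigma> m"] j(2) by simp
    also have "\<dots> = w a \<sigma>" using j unfolding W_def by simp
    finally show ?thesis .
  qed
  have "lin_form (Suc k) z I = y I" if I: "I \<in> lc_coords (Suc ?n)" for I
  proof -
    obtain I' i where i: "I = I' @ [i]" "I' \<in> lc_coords ?n" "i \<in> {1..k+2}"
      using I by (rule lc_coords_Suc_cases)
    have "lin_form (Suc k) z I = lin_form k (w (i + 1)) I'"
      unfolding i(1) lin_form_snoc using Z i(3) by (intro lin_form_cong) auto
    then show ?thesis using w[OF i(2), of "i + 1"] i(1) by simp
  qed
  moreover have "z \<in> vecs (Sig (Suc ?n))" unfolding z_def vecs_def by simp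
  ultimately show ?case by (intro bexI[of _ z]) simp_all
qed

lemma form_map_linear: "coords_linear (form_map k) (Sig (k + 3)) (lc_coords (k + 3))"
  unfolding coords_linear_def form_map_def by (auto simp: vecs_def lin_form_add lin_form_scale)

lemma form_map_bij: "bij_betw (form_map k) (vecs (Sig (k + 3))) (vecs (lc_coords (k + 3)))"
  unfolding bij_betw_def
proof
  show "inj_on (form_map k) (vecs (Sig (k + 3)))"
  proof (rule inj_onI)
    fix x y assume x: "x \<in> vecs (Sig (k + 3))" and y: "y \<in> vecs (Sig (k + 3))"
      and eq: "form_map k x = form_map k y"
    have "lin_form k (\<lambda>\<sigma>. x \<sigma> + (- 1) * y \<sigma>) I = 0" if "I \<in> lc_coords (k + 3)" for I
      using fun_cong[OF eq, of I] that unfolding lin_form_add lin_form_scale form_map_def by simp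
    then have "x \<sigma> + (- 1) * y \<sigma> = 0" if "\<sigma> \<in> Sig (k + 3)" for \<sigma>
      using that by (rule lin_form_kernel)
    then have "x \<sigma> = y \<sigma>" for \<sigma>
      using x y by (cases "\<sigma> \<in> Sig (k + 3)") (simp_all add: vecs_def)
    then show "x = y" by blast
  qed
  show "form_map k ` vecs (Sig (k + 3)) = vecs (lc_coords (k + 3))"
  proof (intro equalityI subsetI)
    fix t assume "t \<in> form_map k ` vecs (Sig (k + 3))"
    then show "t \<in> vecs (lc_coords (k + 3))" unfolding form_map_def vecs_def by auto
  next
    fix t assume t: "t \<in> vecs (lc_coords (k + 3))"
    obtain z where z: "z \<in> vecs (Sig (k + 3))" "\<forall>I\<in>lc_coords (k + 3). lin_form k z I = t I"
      using lin_form_surj by blast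
    have "form_map k z = t" using z(2) t unfolding form_map_def vecs_def by auto
    then show "t \<in> form_map k ` vecs (Sig (k + 3))" using z(1) by blast
  qed
qed

section \<open>Evaluation on Parke--Taylor functions\<close>

text \<open>The product of the reciprocals of \<open>q\<close> along the consecutive pairs of a word.\<close>

fun path_prod :: "(nat \<Rightarrow> nat \<Rightarrow> complex) \<Rightarrow> nat list \<Rightarrow> complex" where
  "path_prod q (a # b # l) = 1 / q a b * path_prod q (b # l)"
| "path_prod q [a] = 1"
| "path_prod q [] = 1"

lemma path_prod_nth: "path_prod q l = (\<Prod>i<length l - 1. 1 / q (l ! i) (l ! Suc i))"
proof (induction q l rule: path_prod.induct)
  case (1 q a b l)
  then show ?case by (simp add: prod.lessThan_Suc_shift del: prod.lessThan_Suc)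
qed simp_all

lemma path_prod_append:
  "path_prod q (xs @ a # ys) = path_prod q (xs @ [a]) * path_prod q (a # ys)"
proof (induction xs)
  case (Cons x xs)
  then show ?case by (cases xs) simp_all
qed simp

lemma parke_taylor_path:
  assumes "\<sigma> \<in> Sig n" "n \<ge> 1"
  shows "parke_taylor n u v \<sigma> = path_prod (pluecker u v) (\<sigma> @ [1])"
proof -
  have len: "length \<sigma> = n" and "\<sigma> ! 0 = 1" using assms Sig_length by (auto simp: Sig_def)
  then have "(\<sigma> @ [1]) ! i = \<sigma> ! i \<and> (\<sigma> @ [1]) ! Suc i = \<sigma> ! (Suc i mod n)" if "i < n" for i
    using that by (cases "Suc i = n") (auto simp: nth_append)
  then show ?thesis unfolding parke_taylor_def path_prod_nth using len by simp
qed

text \<open>All Pluecker coordinates with indices in \<open>{1..n}\<close> are nonzero.\<close>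

definition pluecker_nonzero :: "nat \<Rightarrow> (nat \<Rightarrow> complex) \<Rightarrow> (nat \<Rightarrow> complex) \<Rightarrow> bool" where
  "pluecker_nonzero n u v \<longleftrightarrow> (\<forall>i\<in>{1..n}. \<forall>j\<in>{1..n}. i \<noteq> j \<longrightarrow> pluecker u v i j \<noteq> 0)"

lemma pluecker_swap: "pluecker u v j i = - pluecker u v i j"
  unfolding pluecker_def by simp

lemma pluecker_nonzeroD:
  "pluecker_nonzero n u v \<Longrightarrow> i \<in> {1..n} \<Longrightarrow> j \<in> {1..n} \<Longrightarrow> i \<noteq> j \<Longrightarrow> pluecker u v i j \<noteq> 0"
  unfolding pluecker_nonzero_def by blast

text \<open>
  Inserting the letter \<open>c = Suc n\<close> between adjacent letters \<open>A\<close> and \<open>B\<close> multiplies the Parke--Taylor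
  function by \<open>q A B / (q A c * q c B)\<close>. By the three-term Pluecker relation for \<open>1, A, B, c\<close>, this
  is the difference of the values at \<open>B\<close> and \<open>A\<close> of \<open>q 1 x / (q 1 c * q c x)\<close>.
\<close>

lemma parke_taylor_insert_at:
  fixes u v
  defines "q \<equiv> pluecker u v"
  assumes \<sigma>: "\<sigma> \<in> Sig n" and n: "n \<ge> 3" and k: "k \<in> {2..n}" and nz: "pluecker_nonzero (Suc n) u v"
    and h: "\<And>l. h l = q 1 ((\<sigma> @ [1]) ! l) / (q 1 (Suc n) * q (Suc n) ((\<sigma> @ [1]) ! l))"
  shows "parke_taylor (Suc n) u v (insert_at (Suc n) \<sigma> k) = parke_taylor n u v \<sigma> * (h k - h (k - 1))"
proof -
  let ?s = "\<sigma> @ [1]" and ?c = "Suc n"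
  have len: "length \<sigma> = n" and d: "distinct \<sigma>" and \<sigma>0: "\<sigma> ! 0 = 1" and set: "set \<sigma> = {1..n}"
    using \<sigma> Sig_length by (auto simp: Sig_def)
  have k1: "k - 1 < n" "Suc (k - 1) = k" "1 \<le> k - 1" using k by auto
  \<comment> \<open>The letters on either side of the new one; the last letter is followed by \<open>1\<close>.\<close>
  define A B where "A = ?s ! (k - 1)" and "B = ?s ! k"
  have tk: "take k \<sigma> = take (k - 1) ?s @ [A]"
    using k k1 len take_Suc_conv_app_nth[of "k - 1" \<sigma>] unfolding A_def by (simp add: nth_append)
  have dk: "drop k \<sigma> @ [1] = B # drop (Suc k) ?s"
    using k len Cons_nth_drop_Suc[of k ?s] unfolding B_def by simp
  have s: "?s = take (k - 1) ?s @ A # B # drop (Suc k) ?s"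
  proof -
    have "?s = take k \<sigma> @ (drop k \<sigma> @ [1])" by simp
    also have "\<dots> = (take (k - 1) ?s @ [A]) @ (B # drop (Suc k) ?s)" by (simp only: tk dk)
    finally show ?thesis by (simp only: append_assoc append_Cons append_Nil)
  qed
  have i: "insert_at ?c \<sigma> k @ [1] = take (k - 1) ?s @ A # ?c # B # drop (Suc k) ?s"
  proof -
    have "insert_at ?c \<sigma> k @ [1] = take k \<sigma> @ ?c # (drop k \<sigma> @ [1])"
      unfolding insert_at_def by simp
    also have "\<dots> = (take (k - 1) ?s @ [A]) @ ?c # B # drop (Suc k) ?s" by (simp only: tk dk)
    finally show ?thesis by (simp only: append_assoc append_Cons append_Nil)
  qed
  have "A = \<sigma> ! (k - 1)" using k1 len unfolding A_def by (simp add: nth_append)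
  then have A: "A \<in> {2..n}" using Sig_letter[OF \<sigma> k1(3,1)] by simp
  have B: "B \<in> {1..n}"
    using k len set nth_mem[of k \<sigma>] unfolding B_def by (cases "k = n") (auto simp: nth_append)
  have AB: "A \<noteq> B"
  proof (cases "k = n")
    case True
    then show ?thesis using A len unfolding B_def by (auto simp: nth_append)
  next
    case False
    then show ?thesis using \<open>A = \<sigma> ! (k - 1)\<close> k k1 len nth_eq_iff_index_eq[OF d, of "k - 1" k]
      unfolding B_def by (auto simp: nth_append)
  qed
  have qs: "q A B \<noteq> 0" "q ?c A \<noteq> 0" "q ?c B \<noteq> 0" "q 1 ?c \<noteq> 0" "q A ?c \<noteq> 0"
    using A B AB unfolding q_def by (intro pluecker_nonzeroD[OF nz]; auto)+
  have "q 1 B * q ?c A - q 1 A * q ?c B = - (q 1 ?c * q A B)"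
    unfolding q_def pluecker_def by (simp add: algebra_simps)
  moreover have "q A ?c = - q ?c A" unfolding q_def by (rule pluecker_swap)
  ultimately have rel: "q A B * (h k - h (k - 1)) = q A B * q A B / (q A ?c * q ?c B)"
    unfolding h A_def[symmetric] B_def[symmetric] using qs
    by (simp add: field_simps) algebra
  have "path_prod q (insert_at ?c \<sigma> k @ [1]) =
      path_prod q (take (k - 1) ?s @ [A]) * (1 / q A ?c * (1 / q ?c B * path_prod q (B # drop (Suc k) ?s)))"
    unfolding i path_prod_append[of q _ A "?c # B # drop (Suc k) ?s"] by simp
  moreover have "path_prod q ?s =
      path_prod q (take (k - 1) ?s @ [A]) * (1 / q A B * path_prod q (B # drop (Suc k) ?s))"
    using arg_cong[OF s, of "path_prod q"]
    unfolding path_prod_append[of q _ A "B # drop (Suc k) ?s"] path_prod.simps(1)[of q A B] .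
  moreover have "h k - h (k - 1) = q A B / (q A ?c * q ?c B)" 
    using rel qs(1) by (metis mult_left_cancel times_divide_eq_right)
  ultimately have "path_prod q (insert_at ?c \<sigma> k @ [1]) = path_prod q ?s * (h k - h (k - 1))"
    using qs(1) by (simp only:) simp
  then show ?thesis
    using parke_taylor_path[OF insert_at_Sig[OF \<sigma> k]] parke_taylor_path[OF \<sigma>] n unfolding q_def by simp
qed

text \<open>
  The differences telescope. The term of the last position vanishes, because the word closes up
  with the letter \<open>1\<close> and the Pluecker coordinate with indices \<open>1, 1\<close> is zero.
\<close>

lemma Zform_parke_taylor:
  assumes \<sigma>: "\<sigma> \<in> Sig n" and n: "n \<ge> 3" and a: "a \<in> {2..n}" and nz: "pluecker_nonzero (Suc n) u v"
  shows "Zform (Suc n) a \<sigma> (parke_taylor (Suc n) u v) = pluecker u v 1 a /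
    (pluecker u v (Suc n) 1 * pluecker u v (Suc n) a) * parke_taylor n u v \<sigma>"
proof -
  let ?q = "pluecker u v" and ?c = "Suc n"
  define h where "h = (\<lambda>l. ?q 1 ((\<sigma> @ [1]) ! l) / (?q 1 ?c * ?q ?c ((\<sigma> @ [1]) ! l)))"
  obtain j where j: "1 \<le> j" "j < n" "\<sigma> ! j = a" using \<sigma> a by (rule Sig_index)
  have len: "length \<sigma> = n" using \<sigma> by (rule Sig_length)
  have "Zform (Suc n) a \<sigma> (parke_taylor (Suc n) u v) =
      (\<Sum>k\<in>{Suc j..n}. parke_taylor (Suc n) u v (insert_at (Suc n) \<sigma> k))"
    using Zform_eq[OF \<sigma> _ j(1,2)] n unfolding j(3) by simp
  also have "\<dots> = (\<Sum>k\<in>{Suc j..n}. parke_taylor n u v \<sigma> * (h k - h (k - 1)))"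
    using j(1) by (intro sum.cong refl parke_taylor_insert_at[OF \<sigma> n _ nz]) (auto simp: h_def)
  also have "\<dots> = parke_taylor n u v \<sigma> * (h n - h j)"
    using sum_telescope''[of j n h] j(2) by (simp add: sum_distrib_left[symmetric])
  also have "h n = 0"
  proof -
    have "(\<sigma> @ [1]) ! n = 1" using len by auto
    then show ?thesis unfolding h_def by (simp add: pluecker_def)
  qed
  also have "h j = - (?q 1 a / (?q ?c 1 * ?q ?c a))"
    unfolding h_def using j len pluecker_swap[of u v 1 ?c] by (simp add: nth_append)
  finally show ?thesis by simp
qed

lemma pluecker_nonzero_mono: "pluecker_nonzero n u v \<Longrightarrow> m \<le> n \<Longrightarrow> pluecker_nonzero m u v"
  unfolding pluecker_nonzero_def by auto

lemma lin_form_parke_taylor: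
  assumes "I \<in> lc_coords (k + 3)" "pluecker_nonzero (k + 3) u v"
  shows "lin_form k (parke_taylor (k + 3) u v) I = parke_taylor 3 u v [1, 2, 3] *
    (\<Prod>l<k. pluecker u v 1 (I ! l + 1) / (pluecker u v (l + 4) 1 * pluecker u v (l + 4) (I ! l + 1)))"
  using assms
proof (induction k arbitrary: I)
  case 0
  then show ?case by (simp add: lin_form_def)
next
  case (Suc k)
  have nz: "pluecker_nonzero (Suc (k + 3)) u v" using Suc.prems(2) by simp
  have "I \<in> lc_coords (Suc (k + 3))" using Suc.prems(1) by simp
  then obtain I' i where I: "I = I' @ [i]" "I' \<in> lc_coords (k + 3)" "i \<in> {1..k+2}"
    by (rule lc_coords_Suc_cases)
  have len: "length I' = k" using I(2) by (simp add: lc_coords_def)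
  then have last: "I ! k = i" unfolding I(1) by auto
  let ?f = "\<lambda>I l. pluecker u v 1 (I ! l + 1) / (pluecker u v (l + 4) 1 * pluecker u v (l + 4) (I ! l + 1))"
  have "lin_form (Suc k) (parke_taylor (Suc (k + 3)) u v) I =
      lin_form k (\<lambda>\<sigma>. pluecker u v 1 (i + 1) / (pluecker u v (Suc (k + 3)) 1 *
        pluecker u v (Suc (k + 3)) (i + 1)) * parke_taylor (k + 3) u v \<sigma>) I'"
    unfolding I(1) lin_form_snoc using I(3) by (intro lin_form_cong Zform_parke_taylor nz) auto
  also have "\<dots> = ?f I k * lin_form k (parke_taylor (k + 3) u v) I'"
    unfolding lin_form_scale last by (simp add: add.commute)
  also have "lin_form k (parke_taylor (k + 3) u v) I' = parke_taylor 3 u v [1, 2, 3] * (\<Prod>l<k. ?f I' l)"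
    using I(2) pluecker_nonzero_mono[OF nz] by (intro Suc.IH) auto
  also have "(\<Prod>l<k. ?f I' l) = (\<Prod>l<k. ?f I l)"
    using len by (intro prod.cong) (auto simp: I(1) nth_append)
  finally show ?case by simp
qed

text \<open>
  If \<open>p\<close> is the configuration of points with homogeneous coordinates given by \<open>u\<close> and \<open>v\<close>, in an
  affine chart with denominators \<open>w\<close>, then the linear forms take the values of the Segre
  coordinates of \<open>p\<close> up to a factor that does not depend on the index \<open>I\<close>.
\<close>

lemma form_map_PT_vec:
  assumes n: "n = k + 3" and nz: "pluecker_nonzero n u v"
    and w: "\<And>i. i \<in> {1..n} \<Longrightarrow> w i \<noteq> 0"
    and p: "\<And>i j. i \<in> {1..n} \<Longrightarrow> j \<in> {1..n} \<Longrightarrow> p i - p j = pluecker u v i j / (w i * w j)"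
  shows "form_map k (PT_vec n u v) \<in> mpoint blk (segre_vec n (kap_vec n p))"
proof -
  let ?q = "pluecker u v"
  let ?C = "parke_taylor 3 u v [1, 2, 3] * (\<Prod>l<k. w 1 / (w (l + 4) * ?q (l + 4) 1))"
  have q: "?q i j \<noteq> 0" if "i \<in> {1..n}" "j \<in> {1..n}" "i \<noteq> j" for i j
    using pluecker_nonzeroD[OF nz that] .
  have "[1, 2, 3] \<in> Sig 3" by (simp only: Sig_3 insertI1)
  then have "parke_taylor 3 u v [1, 2, 3] = 1 / ?q 1 2 * (1 / ?q 2 3 * (1 / ?q 3 1))"
    by (simp add: parke_taylor_path)
  then have C3: "parke_taylor 3 u v [1, 2, 3] \<noteq> 0" using q[of 1 2] q[of 2 3] q[of 3 1] n by simp
  have "w 1 / (w (l + 4) * ?q (l + 4) 1) \<noteq> 0" if "l < k" for l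
    using w[of 1] w[of "l + 4"] q[of "l + 4" 1] that n by simp
  then have C: "?C \<noteq> 0" using C3 by simp
  have "form_map k (PT_vec n u v) I = ?C * segre_vec n (kap_vec n p) I" for I
  proof (cases "I \<in> lc_coords n")
    case True
    have r: "I ! l \<in> {1..l+2}" if "l < k" for l
      using True that unfolding lc_coords_iff n by simp
    have "form_map k (PT_vec n u v) I = lin_form k (parke_taylor n u v) I"
      using True unfolding form_map_def n by (auto simp: PT_vec_def intro: lin_form_cong)
    also have "\<dots> = parke_taylor 3 u v [1, 2, 3] *
        (\<Prod>l<k. ?q 1 (I ! l + 1) / (?q (l + 4) 1 * ?q (l + 4) (I ! l + 1)))"
      using True nz unfolding n by (rule lin_form_parke_taylor)
    also have "(\<Prod>l<k. ?q 1 (I ! l + 1) / (?q (l + 4) 1 * ?q (l + 4) (I ! l + 1))) =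
        (\<Prod>l<k. w 1 / (w (l + 4) * ?q (l + 4) 1) * kap_vec n p (Suc l, I ! l))"
    proof (rule prod.cong[OF refl])
      fix l assume "l \<in> {..<k}"
      then have l: "l < k" by simp
      let ?a = "I ! l + 1"
      have mem: "1 \<in> {1..n}" "?a \<in> {1..n}" "l + 4 \<in> {1..n}" using r[OF l] l n by auto
      have ne: "l + 4 \<noteq> ?a" "l + 4 \<noteq> 1" using r[OF l] by auto
      have "(Suc l, I ! l) \<in> kap_coords n" using r[OF l] l n by (simp add: kap_coords_iff)
      then have "kap_vec n p (Suc l, I ! l) = (p 1 - p ?a) / (p (l + 4) - p ?a)"
        unfolding kap_vec_def by (simp add: add.commute)
      also have "\<dots> = (?q 1 ?a / (w 1 * w ?a)) / (?q (l + 4) ?a / (w (l + 4) * w ?a))"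
        using p[OF mem(1,2)] p[OF mem(3,2)] by simp
      finally show "?q 1 ?a / (?q (l + 4) 1 * ?q (l + 4) ?a) =
          w 1 / (w (l + 4) * ?q (l + 4) 1) * kap_vec n p (Suc l, I ! l)"
        using w[OF mem(1)] w[OF mem(2)] w[OF mem(3)] q[OF mem(3,2) ne(1)] q[OF mem(3,1) ne(2)]
        by (simp add: field_simps)
    qed
    also have "parke_taylor 3 u v [1, 2, 3] * \<dots> = ?C * segre_vec n (kap_vec n p) I"
    proof -
      have "n - 3 = k" using n by simp
      then show ?thesis by (simp only: segre_vec_shift[OF True] prod.distrib mult.assoc)
    qed
    finally show ?thesis .
  next
    case False
    then show ?thesis unfolding form_map_def segre_vec_def n by simp
  qed
  then have "form_map k (PT_vec n u v) = (\<lambda>I. ?C * segre_vec n (kap_vec n p) I)" by blast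
  then show ?thesis unfolding mpoint_blk using C by blast
qed

lemma kap_vec_mcoords:
  assumes "p \<in> config n"
  shows "kap_vec n p \<in> mcoords (kap_coords n) fst"
  unfolding mcoords_def
proof (intro CollectI conjI ballI)
  show "kap_vec n p \<in> vecs (kap_coords n)" unfolding vecs_def kap_vec_def by auto
  fix m assume "m \<in> fst ` kap_coords n"
  then have m: "m \<in> {1..n-3}" unfolding kap_coords_def by auto
  then have mem: "(m, 1) \<in> kap_coords n" by (simp add: kap_coords_iff)
  have "p 1 \<noteq> p 2" "p (m + 3) \<noteq> p 2"
    using assms m inj_on_eq_iff[of p "{1..n}"] unfolding config_def by auto
  then show "\<exists>j\<in>kap_coords n. fst j = m \<and> kap_vec n p j \<noteq> 0"
    using mem by (intro bexI[OF _ mem]) (simp add: kap_vec_def numeral_2_eq_2)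
qed

text \<open>
  After a change of basis \<open>(u, v + t * u)\<close> with general \<open>t\<close>, which preserves the Pluecker coordinates,
  no point of the configuration lies at infinity.
\<close>

lemma affine_chart:
  assumes nz: "pluecker_nonzero n u v" and n: "n \<ge> 2"
  shows "\<exists>w p. (\<forall>i\<in>{1..n}. w i \<noteq> 0) \<and> p \<in> config n \<and>
    (\<forall>i\<in>{1..n}. \<forall>j\<in>{1..n}. p i - p j = pluecker u v i j / (w i * w j))"
proof -
  \<comment> \<open>Avoid the finitely many values for which some denominator \<open>v i + t * u i\<close> vanishes.\<close>
  obtain t where t: "t \<notin> (\<lambda>i. - v i / u i) ` {1..n}"
    using ex_new_if_finite[OF infinite_UNIV_char_0] by blast
  define w where "w = (\<lambda>i. v i + t * u i)"
  define p where "p = (\<lambda>i. u i / w i)"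
  have w: "w i \<noteq> 0" if i: "i \<in> {1..n}" for i
  proof
    assume w0: "w i = 0"
    show False
    proof (cases "u i = 0")
      case True
      then have "v i = 0" using w0 unfolding w_def by simp
      have "(if i = 1 then 2 else 1) \<in> {1..n}" "i \<noteq> (if i = 1 then 2 else 1)" using n by auto
      then obtain j where "j \<in> {1..n}" "i \<noteq> j" by metis
      then show False
        using pluecker_nonzeroD[OF nz i] True \<open>v i = 0\<close> unfolding pluecker_def by auto
    next
      case False
      have "t * u i = - v i" using w0 unfolding w_def by (metis add.commute eq_neg_iff_add_eq_0)
      then have "t = - v i / u i" using False by (metis nonzero_mult_div_cancel_right)
      then show False using t i by blast
    qed
  qed
  have p: "p i - p j = pluecker u v i j / (w i * w j)" if "i \<in> {1..n}" "j \<in> {1..n}" for i j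
  proof -
    have "u i * w j - u j * w i = pluecker u v i j"
      unfolding w_def pluecker_def by (simp add: algebra_simps)
    then show ?thesis unfolding p_def using w that by (simp add: field_simps)
  qed
  have "p \<in> config n"
    unfolding config_def
  proof (intro CollectI inj_onI, rule ccontr)
    fix i j assume ij: "i \<in> {1..n}" "j \<in> {1..n}" "p i = p j" "i \<noteq> j"
    then show False using p[OF ij(1,2)] w pluecker_nonzeroD[OF nz ij(1,2,4)] by simp
  qed
  then show ?thesis using w p by (intro exI[of _ w] exI[of _ p] conjI ballI)
qed

section \<open>The index sets of the explicit isomorphism\<close>

lemma lc_coords_5:
  assumes "I \<in> lc_coords 5"
  shows "I \<in> {[1,1], [1,2], [1,3], [2,1], [2,2], [2,3]}"
proof -
  have "length I = 2" using assms by (simp add: lc_coords_def)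
  then obtain a b where ab: "I = [a, b]" by (auto simp: numeral_2_eq_2 length_Suc_conv)
  have "a \<in> {1..2}" "b \<in> {1..3}" using assms lc_coords_iff[of I 5] unfolding ab
    by (force simp: less_Suc_eq numeral_2_eq_2 numeral_3_eq_3)+
  then have "a = 1 \<or> a = 2" "b = 1 \<or> b = 2 \<or> b = 3" by auto
  then show ?thesis unfolding ab by auto
qed

lemma Z_index_4: "Z_index 4 2 [1, 2, 3] = {[1, 2, 3, 4], [1, 2, 4, 3]}"
  "Z_index 4 3 [1, 2, 3] = {[1, 2, 3, 4]}"
proof -
  have s: "[1, 2, 3] \<in> Sig 3" by (simp only: Sig_3 insertI1)
  have i: "{2..3::nat} = {2, 3}" "{3..3::nat} = {3}" by auto
  show "Z_index 4 2 [1, 2, 3] = {[1, 2, 3, 4], [1, 2, 4, 3]}"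
    using Z_index_eq[OF s, of 1] by (simp add: i insert_at_def insert_commute numeral_2_eq_2[symmetric])
  show "Z_index 4 3 [1, 2, 3] = {[1, 2, 3, 4]}"
    using Z_index_eq[OF s, of 2] by (simp add: i insert_at_def)
qed

lemma Z_index_5:
  "Z_index 5 2 [1, 2, 3, 4] = {[1, 2, 3, 4, 5], [1, 2, 3, 5, 4], [1, 2, 5, 3, 4]}"
  "Z_index 5 3 [1, 2, 3, 4] = {[1, 2, 3, 4, 5], [1, 2, 3, 5, 4]}"
  "Z_index 5 4 [1, 2, 3, 4] = {[1, 2, 3, 4, 5]}"
  "Z_index 5 2 [1, 2, 4, 3] = {[1, 2, 4, 3, 5], [1, 2, 4, 5, 3], [1, 2, 5, 4, 3]}"
  "Z_index 5 3 [1, 2, 4, 3] = {[1, 2, 4, 3, 5]}"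
  "Z_index 5 4 [1, 2, 4, 3] = {[1, 2, 4, 3, 5], [1, 2, 4, 5, 3]}"
proof -
  have s: "[1, 2, 3, 4] \<in> Sig 4" "[1, 2, 4, 3] \<in> Sig 4"
    using Z_index_4(1) by (auto simp: Z_index_def)
  have i: "{2..4::nat} = {2, 3, 4}" "{3..4::nat} = {3, 4}" "{4..4::nat} = {4}" by auto
  note z = Z_index_eq[OF s(1), of 1] Z_index_eq[OF s(1), of 2] Z_index_eq[OF s(1), of 3]
    Z_index_eq[OF s(2), of 1] Z_index_eq[OF s(2), of 2] Z_index_eq[OF s(2), of 3]
  note simps = i insert_at_def insert_commute numeral_2_eq_2[symmetric]
  show "Z_index 5 2 [1, 2, 3, 4] = {[1, 2, 3, 4, 5], [1, 2, 3, 5, 4], [1, 2, 5, 3, 4]}"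
    using z(1) by (simp add: simps)
  show "Z_index 5 3 [1, 2, 3, 4] = {[1, 2, 3, 4, 5], [1, 2, 3, 5, 4]}"
    using z(2) by (simp add: simps)
  show "Z_index 5 4 [1, 2, 3, 4] = {[1, 2, 3, 4, 5]}"
    using z(3) by (simp add: simps)
  show "Z_index 5 2 [1, 2, 4, 3] = {[1, 2, 4, 3, 5], [1, 2, 4, 5, 3], [1, 2, 5, 4, 3]}"
    using z(4) by (simp add: simps)
  show "Z_index 5 4 [1, 2, 4, 3] = {[1, 2, 4, 3, 5], [1, 2, 4, 5, 3]}"
    using z(5) by (simp add: simps)
  show "Z_index 5 3 [1, 2, 4, 3] = {[1, 2, 4, 3, 5]}"
    using z(6) by (simp add: simps)
qed

text \<open>The given base case agrees with two steps of the recursion from \<open>n = 3\<close>.\<close>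

lemma form_set_2:
  assumes "I \<in> lc_coords 5"
  shows "form_set 2 I = B5 I"
proof -
  have f: "form_set 2 I =
      (\<Union>\<sigma>\<in>Z_index 4 (last (butlast I) + 1) [1, 2, 3]. Z_index 5 (last I + 1) \<sigma>)"
    unfolding numeral_2_eq_2 form_set.simps by simp
  consider "I = [1,1]" | "I = [1,2]" | "I = [1,3]" | "I = [2,1]" | "I = [2,2]" | "I = [2,3]"
    using lc_coords_5[OF assms] by blast
  then show ?thesis
    unfolding f B5_def
    by cases (simp_all add: Z_index_4[unfolded One_nat_def] Z_index_5[unfolded One_nat_def]
      numeral_2_eq_2[symmetric] insert_commute)
qed

lemma Bset_snoc:
  assumes "k \<ge> 2"
  shows "Bset (Suc (k + 3)) (I @ [i]) = (\<Union>\<sigma>\<in>Bset (k + 3) I. Z_index (Suc (k + 3)) (i + 1) \<sigma>)"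
proof -
  have "Suc (k + 3) \<ge> 6" using assms by simp
  from Bset.simps(2)[OF this, of "I @ [i]"] show ?thesis
    by (simp only: diff_Suc_1 butlast_snoc last_snoc)
qed

lemma Bset_form_set:
  assumes "k \<ge> 2" "I \<in> lc_coords (k + 3)"
  shows "Bset (k + 3) I = form_set k I"
  using assms
proof (induction k arbitrary: I rule: dec_induct)
  case base
  then show ?case using form_set_2 by simp
next
  case (step k)
  have "I \<in> lc_coords (Suc (k + 3))" using step.prems by simp
  then obtain I' i where I: "I = I' @ [i]" "I' \<in> lc_coords (k + 3)" "i \<in> {1..k+2}"
    by (rule lc_coords_Suc_cases)
  have "Bset (Suc (k + 3)) I = (\<Union>\<sigma>\<in>Bset (k + 3) I'. Z_index (Suc (k + 3)) (i + 1) \<sigma>)"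
    unfolding I(1) using step.hyps(1) by (rule Bset_snoc)
  also have "Bset (k + 3) I' = form_set k I'" using I(2) by (rule step.IH)
  finally show ?case by (simp add: I(1))
qed

lemma B_map_form_map: "k \<ge> 2 \<Longrightarrow> B_map (k + 3) = form_map k"
  unfolding B_map_def form_map_def lin_form_def by (auto simp: Bset_form_set fun_eq_iff)

lemma BZ_map_B_map:
  assumes "k \<ge> 2"
  shows "BZ_map (Suc (k + 3)) = B_map (Suc (k + 3))"
proof (intro ext)
  fix z I
  show "BZ_map (Suc (k + 3)) z I = B_map (Suc (k + 3)) z I"
  proof (cases "I \<in> lc_coords (Suc (k + 3))")
    case True
    then obtain I' i where I: "I = I' @ [i]" "I' \<in> lc_coords (k + 3)" "i \<in> {1..k+2}"
      by (rule lc_coords_Suc_cases)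
    have "finite (Bset (k + 3) I')" using Bset_form_set[OF assms I(2)] finite_form_set by simp
    moreover have "Bset (Suc (k + 3)) I = (\<Union>\<sigma>\<in>Bset (k + 3) I'. Z_index (Suc (k + 3)) (i + 1) \<sigma>)"
      unfolding I(1) using assms by (rule Bset_snoc)
    ultimately have "(\<Sum>\<tau>\<in>Bset (Suc (k + 3)) I. z \<tau>) =
        (\<Sum>\<sigma>\<in>Bset (k + 3) I'. Zform (Suc (k + 3)) (i + 1) \<sigma> z)"
      by (simp only: sum_Z_index)
    then show ?thesis using True unfolding BZ_map_def B_map_def
      by (simp only: I(1) diff_Suc_1 butlast_snoc last_snoc if_True)
  next
    case False
    then show ?thesis unfolding BZ_map_def B_map_def by simp
  qed
qed

section \<open>Comparison of the two varieties\<close>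

lemma Sig_nonempty: "Sig n \<noteq> {}" if n: "n \<ge> 3"
proof -
  have "[1..<Suc n] \<in> Sig n" using n unfolding Sig_def by (auto simp: nth_upt simp del: upt_Suc)
  then show ?thesis by blast
qed

text \<open>The points whose closure is the Parke--Taylor variety.\<close>

definition PT_points :: "nat \<Rightarrow> (nat list \<Rightarrow> complex) set set" where
  "PT_points n = {mpoint blk (PT_vec n u v) | V u v.
        V \<in> Gr2 n \<and> plane_basis n V u v \<and>
        (\<forall>i \<in> {1..n}. \<forall>j \<in> {1..n}. i \<noteq> j \<longrightarrow> pluecker u v i j \<noteq> 0)}"

text \<open>The points whose closure is the log canonical embedding.\<close>

definition LC_points :: "nat \<Rightarrow> (nat list \<Rightarrow> complex) set set" where
  "LC_points n = {segre n (mpoint fst (kap_vec n p)) | p. p \<in> config n}"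

text \<open>An affine configuration spans a plane together with the constant vector.\<close>

lemma plane_basis_affine:
  assumes "p \<in> config n" "n \<ge> 2"
  defines "u \<equiv> \<lambda>i. if i \<in> {1..n} then p i else 0" and "v \<equiv> \<lambda>i. if i \<in> {1..n} then 1 else 0"
  shows "plane_basis n {(\<lambda>i. a * u i + b * v i) | a b. True} u v"
  unfolding plane_basis_def
proof (intro conjI allI impI refl)
  show "u \<in> vecs {1..n}" "v \<in> vecs {1..n}" unfolding u_def v_def vecs_def by auto
  fix a b assume "(\<lambda>i. a * u i + b * v i) = (\<lambda>_. 0)"
  then have "a * u 1 + b * v 1 = 0" "a * u 2 + b * v 2 = 0" by metis+
  then have ab: "a * p 1 + b = 0" "a * p 2 + b = 0" using assms(2) unfolding u_def v_def by auto
  then have "a * (p 1 - p 2) = 0" by algebra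
  moreover have "p 1 \<noteq> p 2"
    using assms(1,2) inj_on_eq_iff[of p "{1..n}"] unfolding config_def by auto
  ultimately show "a = 0" by simp
  then show "b = 0" using ab by simp
qed

lemma PT_points_LC_points:
  assumes n: "n = k + 3" and k: "k \<ge> 1"
  shows "PT_points n \<subseteq> mproj_points (Sig n) blk"
    and "(`) (form_map k) ` PT_points n = LC_points n"
proof -
  note lin = form_map_linear[of k, folded n]
  have PT_vec: "PT_vec n u v \<in> vecs (Sig n)" for u v unfolding PT_vec_def vecs_def by simp
  have img: "form_map k ` mpoint blk (PT_vec n u v) = segre n (mpoint fst (kap_vec n p))"
    if "form_map k (PT_vec n u v) \<in> mpoint blk (segre_vec n (kap_vec n p))" for u v p
    using coords_linear_point[OF lin PT_vec] mpoint_eq[OF that] segre_point[of n] n k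
    unfolding segre_def by simp
  have nonzero: "mpoint blk (PT_vec n u v) \<in> mproj_points (Sig n) blk"
    and chart: "\<exists>p\<in>config n. form_map k ` mpoint blk (PT_vec n u v) = segre n (mpoint fst (kap_vec n p))"
    if nz: "pluecker_nonzero n u v" for u v
  proof -
    have "n \<ge> 2" using n by simp
    from affine_chart[OF nz this] obtain w p where wp: "\<forall>i\<in>{1..n}. w i \<noteq> 0" "p \<in> config n"
      "\<forall>i\<in>{1..n}. \<forall>j\<in>{1..n}. p i - p j = pluecker u v i j / (w i * w j)"
      by (elim exE conjE)
    have m: "form_map k (PT_vec n u v) \<in> mpoint blk (segre_vec n (kap_vec n p))"
      using n nz wp(1,3) by (intro form_map_PT_vec[where w = w]) simp_all
    then show "\<exists>p\<in>config n. form_map k ` mpoint blk (PT_vec n u v) = segre n (mpoint fst (kap_vec n p))"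
      using img wp(2) by blast
    have "form_map k (PT_vec n u v) \<in> mcoords (lc_coords n) blk"
      using segre_vec_mcoords[OF kap_vec_mcoords[OF wp(2)]] m by (rule mcoords_mpoint)
    then have "form_map k (PT_vec n u v) \<noteq> (\<lambda>_. 0)" by (simp add: mcoords_blk lc_coords_nonempty)
    then have "PT_vec n u v \<noteq> (\<lambda>_. 0)" using coords_linear_zero[OF lin] by metis
    then show "mpoint blk (PT_vec n u v) \<in> mproj_points (Sig n) blk"
      using PT_vec Sig_nonempty[of n] n by (intro mpoint_in_mproj_points) (simp add: mcoords_blk)
  qed
  show "PT_points n \<subseteq> mproj_points (Sig n) blk"
    using nonzero unfolding PT_points_def pluecker_nonzero_def by blast
  show "(`) (form_map k) ` PT_points n = LC_points n"
  proof (intro equalityI subsetI)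
    fix Q assume "Q \<in> (`) (form_map k) ` PT_points n"
    then obtain u v where uv: "pluecker_nonzero n u v" "Q = form_map k ` mpoint blk (PT_vec n u v)"
      unfolding PT_points_def pluecker_nonzero_def by blast
    then show "Q \<in> LC_points n" using chart[OF uv(1)] unfolding LC_points_def by blast
  next
    fix Q assume "Q \<in> LC_points n"
    then obtain p where p: "p \<in> config n" "Q = segre n (mpoint fst (kap_vec n p))"
      unfolding LC_points_def by blast
    let ?u = "\<lambda>i. if i \<in> {1..n} then p i else 0" and ?v = "\<lambda>i. if i \<in> {1..n} then 1 else (0::complex)"
    have pl: "pluecker ?u ?v i j = p i - p j" if "i \<in> {1..n}" "j \<in> {1..n}" for i j
      using that unfolding pluecker_def by simp
    have nz: "pluecker_nonzero n ?u ?v"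
      unfolding pluecker_nonzero_def using pl p(1) inj_onD[of p "{1..n}"]
      by (auto simp: config_def)
    have "form_map k (PT_vec n ?u ?v) \<in> mpoint blk (segre_vec n (kap_vec n p))"
      using n nz by (rule form_map_PT_vec[where w = "\<lambda>_. 1"]) (use pl in auto)
    then have "Q = form_map k ` mpoint blk (PT_vec n ?u ?v)" using img p(2) by simp
    moreover have "mpoint blk (PT_vec n ?u ?v) \<in> PT_points n"
    proof -
      have b: "plane_basis n {(\<lambda>i. a * ?u i + b * ?v i) | a b. True} ?u ?v"
        using plane_basis_affine[OF p(1)] n by simp
      then have "{(\<lambda>i. a * ?u i + b * ?v i) | a b. True} \<in> Gr2 n" unfolding Gr2_def by blast
      then show ?thesis using b nz unfolding PT_points_def pluecker_nonzero_def by blast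
    qed
    ultimately show "Q \<in> (`) (form_map k) ` PT_points n" by blast
  qed
qed

lemma form_map_iso:
  assumes n: "n = k + 3" and k: "k \<ge> 1"
  shows "linear_iso_between (form_map k) (Sig n) (PT n) (lc_coords n) (LC n)"
proof -
  note lin = form_map_linear[of k, folded n] and bij = form_map_bij[of k, folded n]
  note pts = PT_points_LC_points[OF n k]
  have "closed_embedding (proj_space (Sig n)) (proj_space (lc_coords n)) ((`) (form_map k))"
    using finite_Sig finite_lc_coords Sig_nonempty[of n] lc_coords_nonempty lin bij n
    by (intro linear_closed_embedding) auto
  from closed_embedding_closure[OF this, of "PT_points n"] pts
  have "(`) (form_map k) ` PT n = LC n"
    unfolding PT_def LC_def PT_points_def[symmetric] LC_points_def[symmetric]
    by (simp add: topspace_zariski)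
  then show ?thesis
    unfolding linear_iso_between_def using bij coords_linear_add[OF lin] coords_linear_scale[OF lin]
    by simp
qed

text \<open>
  As \<open>M\<^sub>0\<^sub>,\<^sub>n\<close> is dense, the image of the closed embedding \<open>\<Omega>\<close> is the closure of the explicit points.
\<close>

lemma M0_closure_image:
  assumes "is_M0bar n X \<iota> \<Omega>"
  shows "\<Omega> ` topspace (topo X) =
    zariski (kap_coords n) fst closure_of {mpoint fst (kap_vec n p) | p. p \<in> config n}"
proof -
  have X: "topo X closure_of (\<iota> ` M0 n) = topspace (topo X)" "closed_embedding X (kap_space n) \<Omega>"
    "openin (topo X) (\<iota> ` M0 n)"
    and \<Omega>: "\<And>p. p \<in> config n \<Longrightarrow> \<Omega> (\<iota> (moebius_rel n `` {p})) = mpoint fst (kap_vec n p)"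
    using assms unfolding is_M0bar_def by auto
  have "\<Omega> ` \<iota> ` M0 n = {mpoint fst (kap_vec n p) | p. p \<in> config n}"
  proof -
    have "M0 n = (\<lambda>p. moebius_rel n `` {p}) ` config n" unfolding M0_def quotient_def by auto
    then have "\<Omega> ` \<iota> ` M0 n = (\<lambda>p. \<Omega> (\<iota> (moebius_rel n `` {p}))) ` config n"
      by (simp only: image_image)
    also have "\<dots> = (\<lambda>p. mpoint fst (kap_vec n p)) ` config n" using \<Omega> by (rule image_cong[OF refl])
    finally show ?thesis by blast
  qed
  then show ?thesis
    using closed_embedding_closure[OF X(2), of "\<iota> ` M0 n"] openin_subset[OF X(3)] X(1) by simp
qed

lemma segre_M0bar:
  assumes n: "n \<ge> 4" and X: "is_M0bar n X \<iota> \<Omega>"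
  shows "closed_embedding X (proj_space (lc_coords n)) (segre n \<circ> \<Omega>)"
    and "(segre n \<circ> \<Omega>) ` topspace (topo X) = LC n"
proof -
  have "closed_embedding X (kap_space n) \<Omega>" using X unfolding is_M0bar_def by blast
  then show "closed_embedding X (proj_space (lc_coords n)) (segre n \<circ> \<Omega>)"
    using segre_closed_embedding[OF n] by (rule closed_embedding_compose)
  have "{mpoint fst (kap_vec n p) | p. p \<in> config n} \<subseteq> mproj_points (kap_coords n) fst"
    using kap_vec_mcoords mpoint_in_mproj_points by blast
  then have "segre n ` (zariski (kap_coords n) fst closure_of {mpoint fst (kap_vec n p) | p. p \<in> config n})
    = zariski (lc_coords n) blk closure_of (segre n ` {mpoint fst (kap_vec n p) | p. p \<in> config n})"
    using closed_embedding_closure[OF segre_closed_embedding[OF n]] by (simp add: topspace_zariski)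
  also have "segre n ` {mpoint fst (kap_vec n p) | p. p \<in> config n} = LC_points n"
    unfolding LC_points_def by blast
  finally show "(segre n \<circ> \<Omega>) ` topspace (topo X) = LC n"
    unfolding image_comp[symmetric] M0_closure_image[OF X] LC_def LC_points_def .
qed

theorem theorem3p7:
  fixes n :: nat
    and X :: "'x fspace"
    and \<iota> :: "(nat \<Rightarrow> complex) set \<Rightarrow> 'x"
    and \<Omega> :: "'x \<Rightarrow> (nat \<times> nat \<Rightarrow> complex) set"
  assumes "n \<ge> 4"
  shows "(\<exists>L. linear_iso_between L (Sig n) (PT n) (lc_coords n) (LC n)) \<and>
    (is_M0bar n X \<iota> \<Omega> \<longrightarrow>
       closed_embedding X (proj_space (lc_coords n)) (segre n \<circ> \<Omega>) \<and>
       (segre n \<circ> \<Omega>) ` topspace (topo X) = LC n \<and>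
       (\<exists>\<Psi>. closed_embedding X (proj_space (Sig n)) \<Psi> \<and> \<Psi> ` topspace (topo X) = PT n)) \<and>
    (n \<ge> 6 \<longrightarrow> linear_iso_between (BZ_map n) (Sig n) (PT n) (lc_coords n) (LC n) \<and>
               BZ_map n = B_map n) \<and>
    (n \<ge> 5 \<longrightarrow> linear_iso_between (B_map n) (Sig n) (PT n) (lc_coords n) (LC n))"
proof -
  obtain k where n: "n = k + 3" and k: "k \<ge> 1"
    using assms by (intro that[of "n - 3"]) auto
  let ?L = "form_map k"
  let ?M = "inv_into (vecs (Sig n)) ?L"
  note lin = form_map_linear[of k, folded n] and bij = form_map_bij[of k, folded n]
  note iso = form_map_iso[OF n k]
  have fin: "finite (Sig n)" "finite (lc_coords n)" "Sig n \<noteq> {}" "lc_coords n \<noteq> {}"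
    using finite_Sig finite_lc_coords Sig_nonempty[of n] lc_coords_nonempty n by auto
  have M: "closed_embedding (proj_space (lc_coords n)) (proj_space (Sig n)) ((`) ?M)"
    using fin coords_linear_inv[OF lin bij] bij_betw_inv_into[OF bij]
    by (intro linear_closed_embedding)
  have "PT n \<subseteq> mproj_points (Sig n) blk"
    unfolding PT_def using closure_of_subset_topspace[of "zariski (Sig n) blk"]
    by (simp add: topspace_zariski)
  then have "(`) ?M ` (`) ?L ` PT n = PT n" using fin lin bij by (intro linear_inv_image)
  moreover have "(`) ?L ` PT n = LC n" using iso unfolding linear_iso_between_def by blast
  ultimately have MPT: "(`) ?M ` LC n = PT n" by simp
  have \<Psi>: "\<exists>\<Psi>. closed_embedding X (proj_space (Sig n)) \<Psi> \<and> \<Psi> ` topspace (topo X) = PT n"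
    if X: "is_M0bar n X \<iota> \<Omega>"
  proof (intro exI conjI)
    show "closed_embedding X (proj_space (Sig n)) ((`) ?M \<circ> (segre n \<circ> \<Omega>))"
      using segre_M0bar(1)[OF assms X] M by (rule closed_embedding_compose)
    show "((`) ?M \<circ> (segre n \<circ> \<Omega>)) ` topspace (topo X) = PT n"
      using segre_M0bar(2)[OF assms X] MPT by (metis image_comp)
  qed
  have B: "B_map n = ?L" if "n \<ge> 5" using B_map_form_map[of k] that n by simp
  have BZ: "BZ_map n = B_map n" if "n \<ge> 6"
  proof -
    have "k - 1 \<ge> 2" "Suc (k - 1 + 3) = n" using that n by auto
    then show ?thesis using BZ_map_B_map[of "k - 1"] by metis
  qed
  show ?thesis
  proof (intro conjI impI)
    show "\<exists>L. linear_iso_between L (Sig n) (PT n) (lc_coords n) (LC n)" using iso by blast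
    show "closed_embedding X (proj_space (lc_coords n)) (segre n \<circ> \<Omega>)"
      and "(segre n \<circ> \<Omega>) ` topspace (topo X) = LC n"
      and "\<exists>\<Psi>. closed_embedding X (proj_space (Sig n)) \<Psi> \<and> \<Psi> ` topspace (topo X) = PT n"
      if "is_M0bar n X \<iota> \<Omega>"
      using segre_M0bar[OF assms that] \<Psi>[OF that] by (simp_all only:)
    show "linear_iso_between (BZ_map n) (Sig n) (PT n) (lc_coords n) (LC n)"
      and "BZ_map n = B_map n" if "n \<ge> 6"
      using that iso B BZ by simp_all
    show "linear_iso_between (B_map n) (Sig n) (PT n) (lc_coords n) (LC n)" if "n \<ge> 5"
      using that iso B by simp
  qed
qed

end
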